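(* Let $\mathfrak{A}$ be a $C^*$-algebra, let $H$ be a Hilbert $\mathfrak{A}$-module, and let $A,B\in\mathcal{L}(H)$ be non-zero and such that $|A+B|=|A|+|B|$ and $A+B$ is M-P invertible. Then $A$ and $B$ are parallel summable, and $$\Vert A:B\Vert\le \Vert A\Vert:\Vert B\Vert,$$ where $\Vert A\Vert:\Vert B\Vert=\dfrac{\Vert A\Vert\,\Vert B\Vert}{\Vert A\Vert+\Vert B\Vert}$.
   Context: For a (right) Hilbert $\mathfrak{A}$-module $H$, $\mathcal{L}(H)$ denotes the $C^*$-algebra of adjointable operators $H\to H$. For $T\in\mathcal{L}(H)$, $|T|=(T^*T)^{1/2}$. An operator $T\in\mathcal{L}(H)$ is M-P invertible if there is $X\in\mathcal{L}(H)$ with $TXT=T$, $XTX=X$, $(TX)^*=TX$, $(XT)^*=XT$; such $X$ is unique, is called the Moore-Penrose inverse of $T$, and is denoted $T^\dagger$. If $T$ is M-P invertible, a $\{1\}$-inverse of $T$ is any $T^-\in\mathcal{L}(H)$ with $TT^-T=T$. For $A,B\in\mathcal{L}(H)$ with $A+B$ M-P invertible, $A$ and $B$ are said to be parallel summable if $A(A+B)^-B$ is the same operator for every choice of $\{1\}$-inverse $(A+B)^-$ of $A+B$; in that case the parallel sum is $A:B=A(A+B)^\dagger B$. For real numbers $a,b>0$, $a:b=\frac{ab}{a+b}$. *)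

theory Defs
  imports "HOL-Analysis.Analysis"
begin

text \<open>
  Complex scalars are added on top of the library's real classes, so that norms, completeness
  and the operator norm \<^const>\<open>onorm\<close> are those of HOL-Analysis.
\<close>

class scaleC =
  fixes scaleC :: "complex \<Rightarrow> 'a \<Rightarrow> 'a"  (infixr \<open>*\<^sub>C\<close> 75)

class complex_vector = real_vector + scaleC +
  assumes scaleC_add_right: "c *\<^sub>C (x + y) = c *\<^sub>C x + c *\<^sub>C y"
    and scaleC_add_left: "(c + d) *\<^sub>C x = c *\<^sub>C x + d *\<^sub>C x"
    and scaleC_scaleC: "c *\<^sub>C d *\<^sub>C x = (c * d) *\<^sub>C x"
    and scaleC_one: "1 *\<^sub>C x = x"
    and scaleR_scaleC: "r *\<^sub>R x = complex_of_real r *\<^sub>C x"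

class complex_normed_vector = complex_vector + real_normed_vector +
  assumes norm_scaleC: "norm (c *\<^sub>C x) = cmod c * norm x"

text \<open>C*-algebras; neither a unit nor \<open>0 \<noteq> 1\<close> is assumed.\<close>

class cstar_algebra = complex_normed_vector + real_normed_algebra + banach +
  fixes star :: "'a \<Rightarrow> 'a"
  assumes scaleC_mult_left: "(c *\<^sub>C x) * y = c *\<^sub>C (x * y)"
    and scaleC_mult_right: "x * (c *\<^sub>C y) = c *\<^sub>C (x * y)"
    and star_star: "star (star x) = x"
    and star_add: "star (x + y) = star x + star y"
    and star_scaleC: "star (c *\<^sub>C x) = cnj c *\<^sub>C star x"
    and star_mult: "star (x * y) = star y * star x"
    and cstar_identity: "norm (star x * x) = (norm x)\<^sup>2"

definition cstar_positive :: "'a::cstar_algebra \<Rightarrow> bool" where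
  "cstar_positive a \<longleftrightarrow> (\<exists>b. a = star b * b)"

text \<open>
  Right Hilbert modules over a C*-algebra: \<open>act x a\<close> is \<open>x \<cdot> a\<close>, and the inner product \<open>ip\<close> is
  linear in its second argument. The norm of the carrier type is the one induced by \<open>ip\<close>;
  completeness is part of the sort of the carrier type.
\<close>

locale hilbert_module =
  fixes act :: "'h::{complex_normed_vector, banach} \<Rightarrow> 'a::cstar_algebra \<Rightarrow> 'h"
    and ip :: "'h \<Rightarrow> 'h \<Rightarrow> 'a"
  assumes act_add_left: "act (x + y) a = act x a + act y a"
    and act_add_right: "act x (a + b) = act x a + act x b"
    and act_mult: "act x (a * b) = act (act x a) b"
    and act_scaleC_left: "act (c *\<^sub>C x) a = c *\<^sub>C act x a"
    and act_scaleC_right: "act x (c *\<^sub>C a) = c *\<^sub>C act x a"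
    and ip_add_right: "ip x (y + z) = ip x y + ip x z"
    and ip_scaleC_right: "ip x (c *\<^sub>C y) = c *\<^sub>C ip x y"
    and ip_act_right: "ip x (act y a) = ip x y * a"
    and ip_star: "star (ip x y) = ip y x"
    and ip_positive: "cstar_positive (ip x x)"
    and ip_definite: "ip x x = 0 \<Longrightarrow> x = 0"
    and norm_ip: "norm x = sqrt (norm (ip x x))"

text \<open>
  The algebra of adjointable operators is represented by functions satisfying
  \<open>adjointable ip\<close>, with composition as product. Linearity and boundedness need not be required:
  they follow from the existence of an adjoint. The operator \<open>adj ip T\<close> is meaningful only for
  adjointable \<open>T\<close>.
\<close>

definition adjointable :: "('h \<Rightarrow> 'h \<Rightarrow> 'a) \<Rightarrow> ('h \<Rightarrow> 'h) \<Rightarrow> bool" where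
  "adjointable ip T \<longleftrightarrow> (\<exists>S. \<forall>x y. ip (T x) y = ip x (S y))"

definition adj :: "('h \<Rightarrow> 'h \<Rightarrow> 'a) \<Rightarrow> ('h \<Rightarrow> 'h) \<Rightarrow> ('h \<Rightarrow> 'h)" where
  "adj ip T = (THE S. \<forall>x y. ip (T x) y = ip x (S y))"

definition positive_op :: "('h \<Rightarrow> 'h \<Rightarrow> 'a) \<Rightarrow> ('h \<Rightarrow> 'h) \<Rightarrow> bool" where
  "positive_op ip T \<longleftrightarrow> (\<exists>R. adjointable ip R \<and> T = adj ip R \<circ> R)"

definition sqrt_op :: "('h \<Rightarrow> 'h \<Rightarrow> 'a) \<Rightarrow> ('h \<Rightarrow> 'h) \<Rightarrow> ('h \<Rightarrow> 'h)" where
  "sqrt_op ip P = (THE S. positive_op ip S \<and> S \<circ> S = P)"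

definition abs_op :: "('h \<Rightarrow> 'h \<Rightarrow> 'a) \<Rightarrow> ('h \<Rightarrow> 'h) \<Rightarrow> ('h \<Rightarrow> 'h)" where
  "abs_op ip T = sqrt_op ip (adj ip T \<circ> T)"

definition plus_op :: "('h::plus \<Rightarrow> 'h) \<Rightarrow> ('h \<Rightarrow> 'h) \<Rightarrow> ('h \<Rightarrow> 'h)" where
  "plus_op A B = (\<lambda>x. A x + B x)"

definition is_mp_inverse :: "('h \<Rightarrow> 'h \<Rightarrow> 'a) \<Rightarrow> ('h \<Rightarrow> 'h) \<Rightarrow> ('h \<Rightarrow> 'h) \<Rightarrow> bool" where
  "is_mp_inverse ip T X \<longleftrightarrow> adjointable ip X \<and> T \<circ> X \<circ> T = T \<and> X \<circ> T \<circ> X = X \<and>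
     adj ip (T \<circ> X) = T \<circ> X \<and> adj ip (X \<circ> T) = X \<circ> T"

definition mp_invertible :: "('h \<Rightarrow> 'h \<Rightarrow> 'a) \<Rightarrow> ('h \<Rightarrow> 'h) \<Rightarrow> bool" where
  "mp_invertible ip T \<longleftrightarrow> adjointable ip T \<and> (\<exists>X. is_mp_inverse ip T X)"

definition mp_inverse :: "('h \<Rightarrow> 'h \<Rightarrow> 'a) \<Rightarrow> ('h \<Rightarrow> 'h) \<Rightarrow> ('h \<Rightarrow> 'h)" where
  "mp_inverse ip T = (THE X. is_mp_inverse ip T X)"

text \<open>The \<open>{1}\<close>-inverses.\<close>

definition is_one_inverse :: "('h \<Rightarrow> 'h \<Rightarrow> 'a) \<Rightarrow> ('h \<Rightarrow> 'h) \<Rightarrow> ('h \<Rightarrow> 'h) \<Rightarrow> bool" where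
  "is_one_inverse ip T X \<longleftrightarrow> adjointable ip X \<and> T \<circ> X \<circ> T = T"

definition parallel_summable :: "('h::plus \<Rightarrow> 'h \<Rightarrow> 'a) \<Rightarrow> ('h \<Rightarrow> 'h) \<Rightarrow> ('h \<Rightarrow> 'h) \<Rightarrow> bool" where
  "parallel_summable ip A B \<longleftrightarrow>
     adjointable ip A \<and> adjointable ip B \<and> mp_invertible ip (plus_op A B) \<and>
     (\<forall>X Y. is_one_inverse ip (plus_op A B) X \<longrightarrow> is_one_inverse ip (plus_op A B) Y \<longrightarrow>
        A \<circ> X \<circ> B = A \<circ> Y \<circ> B)"

definition parallel_sum ::
    "('h::plus \<Rightarrow> 'h \<Rightarrow> 'a) \<Rightarrow> ('h \<Rightarrow> 'h) \<Rightarrow> ('h \<Rightarrow> 'h) \<Rightarrow> ('h \<Rightarrow> 'h)" where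
  "parallel_sum ip A B = A \<circ> mp_inverse ip (plus_op A B) \<circ> B"

text \<open>Uniqueness facts that make \<^const>\<open>adj\<close> and \<^const>\<open>mp_inverse\<close> well defined.\<close>

context hilbert_module
begin

lemma ip_right_cancel:
  assumes "\<And>x. ip x y = ip x z"
  shows "y = z"
proof -
  have "ip (y - z) (y - z) + ip (y - z) z = ip (y - z) y"
    by (simp flip: ip_add_right)
  then have "ip (y - z) (y - z) = 0"
    by (simp add: assms)
  then show ?thesis
    using ip_definite by fastforce
qed

lemma adj_unique:
  assumes "\<And>x y. ip (T x) y = ip x (S y)"
  shows "adj ip T = S"
  unfolding adj_def
proof (rule the_equality)
  show "\<forall>x y. ip (T x) y = ip x (S y)"
    using assms by blast
next
  fix S' assume "\<forall>x y. ip (T x) y = ip x (S' y)"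
  then show "S' = S"
    by (intro ext ip_right_cancel) (simp add: assms)
qed

lemma ip_adj:
  assumes "adjointable ip T"
  shows "ip (T x) y = ip x (adj ip T y)"
  using assms adj_unique unfolding adjointable_def by metis

lemma ip_adj_left:
  assumes "adjointable ip T"
  shows "ip (adj ip T x) y = ip x (T y)"
  by (metis assms ip_adj ip_star)

lemma adjointable_comp:
  assumes "adjointable ip S" "adjointable ip T"
  shows "adjointable ip (S \<circ> T)" "adj ip (S \<circ> T) = adj ip T \<circ> adj ip S"
proof -
  have "ip ((S \<circ> T) x) y = ip x ((adj ip T \<circ> adj ip S) y)" for x y
    by (simp add: ip_adj assms)
  then show "adjointable ip (S \<circ> T)" "adj ip (S \<circ> T) = adj ip T \<circ> adj ip S"
    using adj_unique unfolding adjointable_def by blast+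
qed

lemma is_mp_inverse_unique:
  assumes T: "adjointable ip T" and X: "is_mp_inverse ip T X" and Y: "is_mp_inverse ip T Y"
  shows "X = Y"
proof -
  have aX: "adjointable ip X" and aY: "adjointable ip Y"
    using X Y by (auto simp: is_mp_inverse_def)
  note X' = X[unfolded is_mp_inverse_def] and Y' = Y[unfolded is_mp_inverse_def]
  have "T \<circ> X = (T \<circ> Y) \<circ> (T \<circ> X)"
    using Y' by (metis comp_assoc)
  then have "adj ip (T \<circ> X) = adj ip (T \<circ> X) \<circ> adj ip (T \<circ> Y)"
    using adjointable_comp aX aY T by metis
  then have TX: "T \<circ> X = T \<circ> Y"
    using X' Y' by (metis comp_assoc)
  have "X \<circ> T = (X \<circ> T) \<circ> (Y \<circ> T)"
    using Y' by (metis comp_assoc)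
  then have "adj ip (X \<circ> T) = adj ip (Y \<circ> T) \<circ> adj ip (X \<circ> T)"
    using adjointable_comp aX aY T by metis
  then have XT: "X \<circ> T = Y \<circ> T"
    using X' Y' by (metis comp_assoc)
  show ?thesis
    using X' Y' TX XT by (metis comp_assoc)
qed

end

end

theory Submission
  imports Defs
begin

text \<open>
  Write \<open>P = |A|\<close>, \<open>Q = |B|\<close>, \<open>C = A + B\<close> and \<open>G = |C| = P + Q\<close>. As \<open>C\<close> is Moore-Penrose invertible,
  \<open>C = U G\<close> with an adjointable partial isometry \<open>U\<close>, and \<open>G\<close> has a positive Moore-Penrose inverse
  \<open>K\<close>. Put \<open>Z = U* A - P = Q - U* B\<close>. Comparing \<open>A* A = P\<^sup>2\<close> and \<open>B* B = Q\<^sup>2\<close> with the squares of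
  \<open>P + Z\<close> and \<open>Q - Z\<close> shows that \<open>G Z\<close> is skew-adjoint and \<open>Q Z + Z* Q \<ge> Z* Z\<close>. After compression by
  the square root of \<open>K\<close> this becomes \<open>i[Q', S] \<ge> c S\<^sup>2\<close> for a self-adjoint \<open>S\<close> equivalent to \<open>Z\<close>, and such a
  commutator inequality forces \<open>S = 0\<close>. Hence \<open>A = U P\<close> and \<open>B = U Q\<close>. Both factor through \<open>C\<close>,
  which gives parallel summability, and \<open>A C\<^sup>\<dagger> B = U (P K Q)\<close>, where
  \<open>0 \<le> P K Q \<le> t\<^sup>2 P + s\<^sup>2 Q\<close> whenever \<open>s + t = 1\<close>; the optimal weights are
  \<open>t = norm B / (norm A + norm B)\<close> and \<open>s = norm A / (norm A + norm B)\<close>.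
\<close>

section \<open>Square roots and positivity in C*-algebras\<close>

definition sqrt_coeff :: "nat \<Rightarrow> real" where
  "sqrt_coeff n = (-1) ^ n * ((1/2) gchoose n)"

lemma sqrt_coeff_0 [simp]: "sqrt_coeff 0 = 1"
  by (simp add: sqrt_coeff_def)

text \<open>Consecutive coefficients satisfy \<open>(k + 1) * c (k + 1) = (k - 1/2) * c k\<close>,
  and the factor on the right is positive from \<open>k = 1\<close> on, so the sign of
  \<open>c 1\<close> persists.\<close>

lemma sqrt_coeff_Suc_nonpos: "sqrt_coeff (Suc n) \<le> 0"
proof (induction n)
  case 0
  then show ?case by (simp add: sqrt_coeff_def)
next
  case (Suc n)
  have "real (Suc (Suc n)) * sqrt_coeff (Suc (Suc n)) = (real (Suc n) - 1/2) * sqrt_coeff (Suc n)"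
  proof -
    have "real (Suc (Suc n)) * ((1/2) gchoose Suc (Suc n)) = (1/2 - real (Suc n)) * ((1/2) gchoose Suc n)"
      using gbinomial_mult_1[of "1/2::real" "Suc n"] by (simp add: algebra_simps)
    then have "(-1) ^ n * (real (Suc (Suc n)) * ((1/2) gchoose Suc (Suc n)))
        = (-1) ^ n * ((1/2 - real (Suc n)) * ((1/2) gchoose Suc n))"
      by simp
    then show ?thesis by (simp add: sqrt_coeff_def algebra_simps)
  qed
  also have "\<dots> \<le> 0"
    using Suc by (intro mult_nonneg_nonpos) auto
  finally show ?case
    by (simp add: mult_le_0_iff)
qed

text \<open>The partial sums are the Taylor coefficients of \<open>(1 - x) powr (-1/2)\<close>,
  whose recurrence has only positive factors.\<close>

lemma sqrt_coeff_sum_nonneg: "0 \<le> (\<Sum>k\<le>m. sqrt_coeff k)"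
proof -
  have "(\<Sum>k\<le>m. sqrt_coeff k) = (-1) ^ m * ((-1/2) gchoose m)"
    using gbinomial_sum_lower_neg[of "1/2::real" m] by (simp add: sqrt_coeff_def mult.commute)
  moreover have "0 \<le> (-1) ^ m * ((-1/2 :: real) gchoose m)"
  proof (induction m)
    case (Suc n)
    have "real (Suc n) * ((-1/2) gchoose Suc n) = (-1/2 - real n) * ((-1/2) gchoose n)"
      using gbinomial_mult_1[of "-1/2::real" "n"] by (simp add: algebra_simps)
    then have "(-1) ^ Suc n * (real (Suc n) * ((-1/2) gchoose Suc n))
        = (-1) ^ Suc n * ((-1/2 - real n) * ((-1/2) gchoose n))"
      by (simp only:)
    also have "\<dots> = (real n + 1/2) * ((-1) ^ n * ((-1/2) gchoose n))"
      by (simp add: algebra_simps)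
    finally have "real (Suc n) * ((-1) ^ Suc n * ((-1/2) gchoose Suc n))
        = (real n + 1/2) * ((-1) ^ n * ((-1/2) gchoose n))"
      by (simp only: mult.left_commute)
    also have "\<dots> \<ge> 0"
      using Suc by (intro mult_nonneg_nonneg[OF _ Suc.IH]) auto
    finally have "real (Suc n) * 0 \<le> real (Suc n) * ((-1) ^ Suc n * ((-1/2) gchoose Suc n))"
      by (simp only: mult_zero_right)
    then show ?case
      by (rule mult_left_le_imp_le) simp
  qed simp
  ultimately show ?thesis by simp
qed

text \<open>All terms after the leading 1 have the same sign and never bring a partial sum below 0.
  The exact bound 1 is what later makes the root positive.\<close>

lemma sqrt_coeff_abs_sum: "(\<Sum>k<m. \<bar>sqrt_coeff (Suc k)\<bar>) \<le> 1"
proof -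
  have "(\<Sum>k<m. \<bar>sqrt_coeff (Suc k)\<bar>) = - (\<Sum>k<m. sqrt_coeff (Suc k))"
    by (simp add: abs_of_nonpos sqrt_coeff_Suc_nonpos sum_negf)
  also have "(\<Sum>k<m. sqrt_coeff (Suc k)) = (\<Sum>k\<le>m. sqrt_coeff k) - 1"
    by (subst sum.atMost_shift) simp
  finally show ?thesis
    using sqrt_coeff_sum_nonneg[of m] by linarith
qed

lemma summable_abs_sqrt_coeff: "summable (\<lambda>n. \<bar>sqrt_coeff n\<bar>)"
proof -
  have "summable (\<lambda>n. \<bar>sqrt_coeff (Suc n)\<bar>)"
    by (rule summableI_nonneg_bounded[where x = 1]) (auto simp: sqrt_coeff_abs_sum)
  then show ?thesis
    using summable_Suc_iff by blast
qed

text \<open>Vandermonde's identity for 1/2 + 1/2 = 1: the Cauchy square of the series is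
  \<open>1 - x\<close>.\<close>

lemma sqrt_coeff_convolution:
  "(\<Sum>i\<le>n. sqrt_coeff i * sqrt_coeff (n - i)) = (if n = 0 then 1 else if n = 1 then -1 else 0)"
proof -
  have "(\<Sum>i\<le>n. sqrt_coeff i * sqrt_coeff (n - i))
      = (\<Sum>i\<le>n. (-1) ^ n * (((1/2) gchoose i) * ((1/2) gchoose (n - i))))"
    unfolding sqrt_coeff_def
    by (intro sum.cong refl) (auto simp flip: power_add)
  also have "\<dots> = (-1) ^ n * ((1::real) gchoose n)"
    using gbinomial_Vandermonde[of "1/2::real" "1/2" n]
    by (simp add: atLeast0AtMost flip: sum_distrib_left)
  also have "(1::real) gchoose n = of_nat (1 choose n)"
    by (metis binomial_gbinomial of_nat_1)
  finally show ?thesis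
    by (cases n) auto
qed

text \<open>Lifts a product rule to right-nested products, so that it still rewrites after
  normalising with \<open>mult.assoc\<close>.\<close>

lemma mult_assoc_ext:
  fixes a b c z :: "'a::semigroup_mult"
  shows "a * b = c \<Longrightarrow> a * (b * z) = c * z"
  by (simp flip: mult.assoc)

text \<open>
  A unital C*-algebra sitting as a closed subset \<open>M\<close> inside a Banach algebra. The unit may be zero,
  which is why \<^class>\<open>real_normed_algebra_1\<close> cannot be used; the element \<open>J\<close> plays the role of
  the imaginary unit.
\<close>

locale unital_cstar =
  fixes M :: "'b::{real_normed_algebra, monoid_mult, banach} set"
    and st :: "'b \<Rightarrow> 'b"
    and J :: 'b
  assumes closed_M: "closed M"
    and one_M [simp]: "1 \<in> M"
    and J_M [simp]: "J \<in> M"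
    and add_M [simp]: "x \<in> M \<Longrightarrow> y \<in> M \<Longrightarrow> x + y \<in> M"
    and mult_M [simp]: "x \<in> M \<Longrightarrow> y \<in> M \<Longrightarrow> x * y \<in> M"
    and scaleR_M [simp]: "x \<in> M \<Longrightarrow> r *\<^sub>R x \<in> M"
    and st_M [simp]: "x \<in> M \<Longrightarrow> st x \<in> M"
    and st_st [simp]: "x \<in> M \<Longrightarrow> st (st x) = x"
    and st_add [simp]: "x \<in> M \<Longrightarrow> y \<in> M \<Longrightarrow> st (x + y) = st x + st y"
    and st_mult [simp]: "x \<in> M \<Longrightarrow> y \<in> M \<Longrightarrow> st (x * y) = st y * st x"
    and st_scaleR [simp]: "x \<in> M \<Longrightarrow> st (r *\<^sub>R x) = r *\<^sub>R st x"
    and cstar: "x \<in> M \<Longrightarrow> norm (st x * x) = (norm x)\<^sup>2"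
    and J_comm: "x \<in> M \<Longrightarrow> x * J = J * x"
    and J_J: "J * J = - 1"
    and st_J [simp]: "st J = - J"
begin

lemma zero_M [simp]: "0 \<in> M"
  using scaleR_M[of 1 0] by simp

lemma uminus_M [simp]: "x \<in> M \<Longrightarrow> - x \<in> M"
  using scaleR_M[of x "-1"] by simp

lemma diff_M [simp]: "x \<in> M \<Longrightarrow> y \<in> M \<Longrightarrow> x - y \<in> M"
  using add_M[of x "- y"] by simp

lemma power_M [simp]: "x \<in> M \<Longrightarrow> x ^ n \<in> M"
  by (induction n) auto

lemma st_zero [simp]: "st 0 = 0"
  using st_scaleR[of 1 0] by simp

lemma st_uminus [simp]: "x \<in> M \<Longrightarrow> st (- x) = - st x"
  using st_scaleR[of x "-1"] by simp

lemma st_diff [simp]: "x \<in> M \<Longrightarrow> y \<in> M \<Longrightarrow> st (x - y) = st x - st y"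
  using st_add[of x "- y"] by simp

lemma st_one [simp]: "st 1 = 1"
  by (metis mult.left_neutral mult.right_neutral one_M st_M st_mult st_st)

lemma st_power [simp]: "x \<in> M \<Longrightarrow> st (x ^ n) = st x ^ n"
  by (induction n) (auto simp: power_commutes)

text \<open>Only an inequality, because the unit may be zero.\<close>

lemma norm_one_le: "norm (1::'b) \<le> 1"
proof -
  have "norm (1::'b) = (norm (1::'b))\<^sup>2"
    using cstar[of 1] by simp
  then have "norm (1::'b) = 0 \<or> norm (1::'b) = 1"
    by (auto simp: power2_eq_square)
  then show ?thesis by auto
qed

lemma norm_scaleR_one_le: "norm (r *\<^sub>R (1::'b)) \<le> \<bar>r\<bar>"
  using norm_one_le by (simp add: mult_left_le)

lemma norm_st [simp]:
  assumes "x \<in> M"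
  shows "norm (st x) = norm x"
proof -
  have le: "norm y \<le> norm (st y)" if "y \<in> M" for y
  proof (cases "norm y = 0")
    case False
    have "norm y * norm y \<le> norm (st y) * norm y"
      using cstar[OF that] norm_mult_ineq[of "st y" y] by (simp add: power2_eq_square)
    then show ?thesis using False by auto
  qed auto
  show ?thesis
    using le[of x] le[of "st x"] assms by auto
qed

lemma norm_power_le_one:
  fixes x :: 'b
  assumes "norm x \<le> 1"
  shows "norm (x ^ n) \<le> 1"
proof (induction n)
  case (Suc n)
  have "norm (x * x ^ n) \<le> norm x * norm (x ^ n)" by (rule norm_mult_ineq)
  also have "\<dots> \<le> 1" using assms Suc by (simp add: mult_le_one)
  finally show ?case by simp
qed (simp add: norm_one_le)

lemma eq_zero_if_st_mult_zero: "x \<in> M \<Longrightarrow> st x * x = 0 \<Longrightarrow> x = 0"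
  using cstar[of x] by auto

definition sa :: "'b \<Rightarrow> bool" where
  "sa x \<longleftrightarrow> x \<in> M \<and> st x = x"

lemma sa_intros [simp]:
  "sa 0" "sa 1" "sa x \<Longrightarrow> sa y \<Longrightarrow> sa (x + y)" "sa x \<Longrightarrow> sa y \<Longrightarrow> sa (x - y)"
  "sa x \<Longrightarrow> sa (- x)" "sa x \<Longrightarrow> sa (r *\<^sub>R x)" "sa x \<Longrightarrow> sa (x ^ n)"
  "x \<in> M \<Longrightarrow> sa (st x * x)"
  by (auto simp: sa_def)

lemma sa_mult: "sa x \<Longrightarrow> sa y \<Longrightarrow> x * y = y * x \<Longrightarrow> sa (x * y)"
  by (simp add: sa_def)

lemma saI: "x \<in> M \<Longrightarrow> st x = x \<Longrightarrow> sa x"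
  by (simp add: sa_def)

lemma sa_M [simp]: "sa x \<Longrightarrow> x \<in> M" and sa_st [simp]: "sa x \<Longrightarrow> st x = x"
  by (auto simp: sa_def)

lemma norm_sa_sq: "sa x \<Longrightarrow> norm (x * x) = (norm x)\<^sup>2"
  using cstar[of x] by simp

lemma sa_sq_zero: "sa x \<Longrightarrow> x * x = 0 \<Longrightarrow> x = 0"
  using eq_zero_if_st_mult_zero[of x] by simp

section \<open>The square root of \<open>1 - x\<close> as a power series on the closed unit
  ball\<close>

definition rt :: "'b \<Rightarrow> 'b" where
  "rt x = (\<Sum>n. sqrt_coeff n *\<^sub>R x ^ n)"

lemma summable_norm_rt:
  fixes x :: 'b
  assumes "norm x \<le> 1"
  shows "summable (\<lambda>n. norm (sqrt_coeff n *\<^sub>R x ^ n))"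
  by (rule summable_comparison_test[OF _ summable_abs_sqrt_coeff])
    (auto simp: norm_power_le_one[OF assms] mult_left_le)

lemma summable_rt:
  fixes x :: 'b
  assumes "norm x \<le> 1"
  shows "summable (\<lambda>n. sqrt_coeff n *\<^sub>R x ^ n)"
  using summable_norm_rt[OF assms] by (rule summable_norm_cancel)

lemma rt_sq:
  assumes "norm x \<le> 1"
  shows "rt x * rt x = 1 - x"
proof -
  have "rt x * rt x = (\<Sum>k. \<Sum>i\<le>k. (sqrt_coeff i *\<^sub>R x ^ i) * (sqrt_coeff (k - i) *\<^sub>R x ^ (k - i)))"
    unfolding rt_def by (rule Cauchy_product[OF summable_norm_rt summable_norm_rt]) fact+
  also have "\<dots> = (\<Sum>k. (\<Sum>i\<le>k. sqrt_coeff i * sqrt_coeff (k - i)) *\<^sub>R x ^ k)"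
    unfolding scaleR_sum_left
    by (intro suminf_cong sum.cong refl) (simp add: mult.commute flip: power_add)
  also have "\<dots> = (\<Sum>k\<in>{0,1}. (\<Sum>i\<le>k. sqrt_coeff i * sqrt_coeff (k - i)) *\<^sub>R x ^ k)"
    unfolding sqrt_coeff_convolution by (rule suminf_finite) auto
  also have "\<dots> = 1 - x"
    unfolding sqrt_coeff_convolution by simp
  finally show ?thesis .
qed

text \<open>This places \<open>rt x\<close> in the ball of radius 1 around the unit, which is
  positivity in the sense of \<open>pos\<close> below.\<close>

lemma norm_one_minus_rt:
  fixes x :: 'b
  assumes "norm x \<le> 1"
  shows "norm (1 - rt x) \<le> 1"
proof -
  let ?f = "\<lambda>n. sqrt_coeff (Suc n) *\<^sub>R x ^ Suc n"
  have s: "summable (\<lambda>n. norm (?f n))"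
    using summable_norm_rt[OF assms] summable_Suc_iff[of "\<lambda>n. norm (sqrt_coeff n *\<^sub>R x ^ n)"] by blast
  have "(\<Sum>n. ?f n) = rt x - 1"
    using suminf_split_head[OF summable_rt[OF assms]] by (simp add: rt_def)
  then have "norm (1 - rt x) \<le> (\<Sum>n. norm (?f n))"
    using summable_norm[OF s] by (simp add: norm_minus_commute)
  also have "\<dots> \<le> 1"
  proof (rule suminf_le_const[OF s])
    fix n
    have "(\<Sum>k<n. norm (?f k)) \<le> (\<Sum>k<n. \<bar>sqrt_coeff (Suc k)\<bar>)"
      using norm_power_le_one[OF assms] by (intro sum_mono) (simp add: mult_left_le del: power_Suc)
    then show "(\<Sum>k<n. norm (?f k)) \<le> 1"
      using sqrt_coeff_abs_sum[of n] by linarith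
  qed
  finally show ?thesis .
qed

text \<open>Intertwining passes to powers and then to the series. With \<open>x = y\<close> it says
  that the root commutes with whatever commutes with \<open>x\<close>.\<close>

lemma rt_intertwine:
  fixes x y w :: 'b
  assumes "norm x \<le> 1" "norm y \<le> 1" "w * x = y * w"
  shows "w * rt x = rt y * w"
proof -
  have p: "w * x ^ n = y ^ n * w" for n
    by (induction n) (auto simp: assms(3) mult.assoc power_commutes, metis assms(3) mult.assoc)
  have "w * rt x = (\<Sum>n. w * (sqrt_coeff n *\<^sub>R x ^ n))"
    unfolding rt_def by (rule suminf_mult[OF summable_rt[OF assms(1)], symmetric])
  also have "\<dots> = (\<Sum>n. sqrt_coeff n *\<^sub>R y ^ n * w)"
    by (simp add: p)
  also have "\<dots> = rt y * w"
    unfolding rt_def by (rule suminf_mult2[OF summable_rt[OF assms(2)], symmetric])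
  finally show ?thesis .
qed

lemma sa_rt:
  assumes "norm x \<le> 1" "sa x"
  shows "sa (rt x)"
proof -
  let ?s = "\<lambda>n. \<Sum>k<n. sqrt_coeff k *\<^sub>R x ^ k"
  have sa: "sa (?s n)" for n
    by (induction n) (use assms in auto)
  have lim: "?s \<longlonglongrightarrow> rt x"
    using summable_LIMSEQ[OF summable_rt[OF assms(1)]] unfolding rt_def .
  have M: "rt x \<in> M"
    using closed_sequentially[OF closed_M _ lim] sa by auto
  \<comment> \<open>As \<open>st\<close> is isometric, the self-adjoint partial sums also converge
    to \<open>st (rt x)\<close>.\<close>
  have "norm (?s n - st (rt x)) = norm (?s n - rt x)" for n
    using norm_st[of "?s n - rt x"] sa M by simp
  then have "?s \<longlonglongrightarrow> st (rt x)"
    using lim unfolding tendsto_dist_iff[of _ "rt x"] tendsto_dist_iff[of _ "st (rt x)"] dist_norm by simp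
  then show ?thesis
    using lim M LIMSEQ_unique unfolding sa_def by blast
qed

section \<open>The cone of positive elements\<close>

text \<open>Positivity without spectral theory: for self-adjoint \<open>a\<close> the norm condition
  says that the spectrum lies between 0 and \<open>2 * s\<close>. It is stable under sums and puts
  \<open>a\<close> within reach of the series \<open>rt\<close>.\<close>

definition pos :: "'b \<Rightarrow> bool" where
  "pos a \<longleftrightarrow> sa a \<and> (\<exists>s>0. norm (s *\<^sub>R 1 - a) \<le> s)"

lemma pos_sa: "pos a \<Longrightarrow> sa a"
  by (simp add: pos_def)

lemma pos_M [simp]: "pos a \<Longrightarrow> a \<in> M" and pos_st [simp]: "pos a \<Longrightarrow> st a = a"
  by (auto simp: pos_sa)

lemma posI: "sa a \<Longrightarrow> s > 0 \<Longrightarrow> norm (s *\<^sub>R 1 - a) \<le> s \<Longrightarrow> pos a"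
  unfolding pos_def by blast

lemma norm_shift_mono:
  fixes a :: 'b
  assumes "norm (s *\<^sub>R 1 - a) \<le> s" "s \<le> t"
  shows "norm (t *\<^sub>R 1 - a) \<le> t"
proof -
  have "t *\<^sub>R 1 - a = (t - s) *\<^sub>R 1 + (s *\<^sub>R 1 - a)"
    by (simp add: algebra_simps)
  then have "norm (t *\<^sub>R 1 - a) \<le> norm ((t - s) *\<^sub>R (1::'b)) + norm (s *\<^sub>R 1 - a)"
    by (metis norm_triangle_ineq)
  then show ?thesis
    using assms norm_scaleR_one_le[of "t - s"] by linarith
qed

lemma pos_add:
  assumes "pos a" "pos b"
  shows "pos (a + b)"
proof -
  obtain s t where st: "s > 0" "t > 0" "norm (s *\<^sub>R 1 - a) \<le> s" "norm (t *\<^sub>R 1 - b) \<le> t"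
    using assms unfolding pos_def by blast
  have "norm ((s + t) *\<^sub>R 1 - (a + b)) \<le> norm (s *\<^sub>R 1 - a) + norm (t *\<^sub>R 1 - b)"
    using norm_triangle_ineq[of "s *\<^sub>R 1 - a" "t *\<^sub>R 1 - b"] by (simp add: algebra_simps)
  then show ?thesis
    using st assms by (intro posI[of _ "s + t"]) (auto simp: pos_sa)
qed

lemma pos_0 [simp]: "pos 0"
  by (rule posI[of _ 1]) (auto simp: norm_one_le)

lemma pos_scaleR_one: "r \<ge> 0 \<Longrightarrow> pos (r *\<^sub>R 1)"
  by (cases "r = 0") (auto intro!: posI[of _ r])

lemma pos_scaleR:
  assumes "pos a" "r \<ge> 0"
  shows "pos (r *\<^sub>R a)"
proof (cases "r = 0")
  case False
  obtain s where s: "s > 0" "norm (s *\<^sub>R 1 - a) \<le> s"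
    using assms unfolding pos_def by blast
  have "(r * s) *\<^sub>R 1 - r *\<^sub>R a = r *\<^sub>R (s *\<^sub>R 1 - a)"
    by (simp add: algebra_simps)
  then have "norm ((r * s) *\<^sub>R 1 - r *\<^sub>R a) \<le> r * s"
    using s assms by (metis abs_of_nonneg mult_left_mono norm_scaleR)
  then show ?thesis
    using assms s False by (intro posI[of _ "r * s"]) (auto simp: pos_sa)
qed simp

text \<open>The root of \<open>a = s * (1 - (1 - a / s))\<close>. Keeping \<open>s\<close> as a
  parameter allows one series to serve two elements at once.\<close>

definition scaled_rt :: "real \<Rightarrow> 'b \<Rightarrow> 'b" where
  "scaled_rt s a = sqrt s *\<^sub>R rt (1 - (1/s) *\<^sub>R a)"

lemma norm_scaled:
  fixes a :: 'b
  assumes "s > 0" "norm (s *\<^sub>R 1 - a) \<le> s"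
  shows "norm (1 - (1/s) *\<^sub>R a) \<le> 1"
proof -
  have "1 - (1/s) *\<^sub>R a = (1/s) *\<^sub>R (s *\<^sub>R 1 - a)"
    using assms by (simp add: algebra_simps)
  then show ?thesis
    using assms by (simp add: divide_le_eq)
qed

lemma scaled_rt_sq:
  fixes a :: 'b
  assumes "s > 0" "norm (s *\<^sub>R 1 - a) \<le> s"
  shows "scaled_rt s a * scaled_rt s a = a"
  using rt_sq[OF norm_scaled[OF assms]] assms by (simp add: scaled_rt_def)

lemma pos_scaled_rt:
  assumes "s > 0" "norm (s *\<^sub>R 1 - a) \<le> s" "sa a"
  shows "pos (scaled_rt s a)"
proof -
  have "pos (rt (1 - (1/s) *\<^sub>R a))"
    using norm_one_minus_rt[OF norm_scaled[OF assms(1,2)]] sa_rt[OF norm_scaled[OF assms(1,2)]] assms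
    by (intro posI[of _ 1]) auto
  then show ?thesis
    unfolding scaled_rt_def using assms by (intro pos_scaleR) auto
qed

lemma scaled_rt_intertwine:
  fixes a b w :: 'b
  assumes "s > 0" "norm (s *\<^sub>R 1 - a) \<le> s" "norm (s *\<^sub>R 1 - b) \<le> s" "w * a = b * w"
  shows "w * scaled_rt s a = scaled_rt s b * w"
proof -
  have "w * rt (1 - (1/s) *\<^sub>R a) = rt (1 - (1/s) *\<^sub>R b) * w"
    by (rule rt_intertwine) (use norm_scaled assms in \<open>auto simp: algebra_simps\<close>)
  then show ?thesis
    by (simp add: scaled_rt_def)
qed

text \<open>Here \<open>d + J * k\<close> is a multiple of a unitary element.\<close>

lemma norm_le_of_sum_squares:
  assumes "sa d" "sa k" "d * k = k * d" "d * d + k * k = r\<^sup>2 *\<^sub>R 1" "r \<ge> 0"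
  shows "norm d \<le> r"
proof -
  define u where "u = d + J * k"
  have M: "d \<in> M" "k \<in> M" "u \<in> M" and st_u: "st u = d - J * k"
    using assms by (auto simp: u_def J_comm)
  have "J * k * (J * k) = J * (k * J) * k"
    by (simp add: mult.assoc)
  also have "\<dots> = - (k * k)"
    by (simp add: J_comm M J_J flip: mult.assoc)
  finally have JJ: "J * k * (J * k) = - (k * k)" .
  have "d * (J * k) = J * k * d"
    by (metis J_comm M(1) assms(3) mult.assoc)
  then have "st u * u = d * d - J * k * (J * k)"
    unfolding st_u by (simp add: u_def left_diff_distrib distrib_left)
  then have "st u * u = d * d + k * k"
    by (simp add: JJ)
  then have "(norm u)\<^sup>2 \<le> r\<^sup>2"
    using cstar[OF M(3)] norm_scaleR_one_le[of "r\<^sup>2"] assms by simp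
  then have u: "norm u \<le> r"
    using assms(5) by (rule power2_le_imp_le)
  have "2 *\<^sub>R d = u + st u"
    unfolding st_u by (simp add: u_def scaleR_2)
  then have "2 * norm d \<le> norm u + norm (st u)"
    by (metis abs_numeral norm_scaleR norm_triangle_ineq)
  then show ?thesis
    using u M by simp
qed

text \<open>The element in the norm is \<open>k * k\<close>, where \<open>k\<close> is its root.
  Since \<open>d * d + k * k\<close> is a scalar, the preceding lemma applied to \<open>k\<close>
  bounds \<open>norm k\<close> by \<open>norm d\<close>.\<close>

lemma norm_shift_sq:
  assumes "sa d" "norm d > 0"
  shows "norm ((norm d)\<^sup>2 *\<^sub>R 1 - d * d) \<le> (norm d)\<^sup>2"
proof -
  define s where "s = norm d"
  define x where "x = (1/s\<^sup>2) *\<^sub>R (d * d)"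
  define k where "k = s *\<^sub>R rt x"
  have s: "s > 0" using assms s_def by simp
  have x: "norm x \<le> 1"
    using norm_sa_sq[OF assms(1)] s by (simp add: x_def s_def)
  have sx: "sa x"
    using assms by (simp add: x_def sa_mult)
  have kk: "k * k = s\<^sup>2 *\<^sub>R 1 - d * d"
  proof -
    have "k * k = s\<^sup>2 *\<^sub>R (rt x * rt x)" by (simp add: k_def power2_eq_square)
    then show ?thesis
      unfolding rt_sq[OF x] using s by (simp add: x_def scaleR_diff_right)
  qed
  have "d * x = x * d" by (simp add: x_def mult.assoc)
  then have dk: "d * k = k * d"
    using rt_intertwine[OF x x] by (simp add: k_def)
  have sk: "sa k" using sa_rt[OF x sx] by (simp add: k_def)
  have "norm k \<le> s"
    using norm_le_of_sum_squares[of k d s] assms sk dk kk s by simp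
  then have "(norm k)\<^sup>2 \<le> s\<^sup>2" by (simp add: power_mono)
  then show ?thesis
    using norm_sa_sq[OF sk] by (simp add: kk s_def)
qed

lemma pos_sq:
  assumes "sa d"
  shows "pos (d * d)"
proof (cases "norm d = 0")
  case False
  then show ?thesis
    using norm_shift_sq[OF assms] assms by (intro posI[of _ "(norm d)\<^sup>2"]) (auto simp: sa_mult)
qed simp

lemma pos_root_exists:
  assumes "pos a"
  shows "\<exists>y. pos y \<and> y * y = a \<and> (\<forall>w. w * a = a * w \<longrightarrow> w * y = y * w)"
proof -
  obtain s where s: "s > 0" "norm (s *\<^sub>R 1 - a) \<le> s"
    using assms unfolding pos_def by blast
  show ?thesis
    using scaled_rt_sq[OF s] pos_scaled_rt[OF s pos_sa[OF assms]] scaled_rt_intertwine[OF s s(2)]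
    by blast
qed

text \<open>The roots inherit commutation, so \<open>a * b\<close> is the square of the self-adjoint
  product of the roots.\<close>

lemma pos_mult_commuting:
  assumes "pos a" "pos b" "a * b = b * a"
  shows "pos (a * b)"
proof -
  obtain y where y: "pos y" "y * y = a" "\<And>w. w * a = a * w \<Longrightarrow> w * y = y * w"
    using pos_root_exists[OF assms(1)] by blast
  obtain z where z: "pos z" "z * z = b" "\<And>w. w * b = b * w \<Longrightarrow> w * z = z * w"
    using pos_root_exists[OF assms(2)] by blast
  have "y * z = z * y"
    using y(3)[of b] z(3)[of y] assms(3) by simp
  moreover from this have "(y * z) * (y * z) = a * b"
    by (metis mult.assoc y(2) z(2))
  ultimately show ?thesis
    using pos_sq[of "y * z"] sa_mult[of y z] y z pos_sa by metis
qed

lemma pos_norm_diff: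
  assumes "pos a" "norm a \<le> t"
  shows "pos (t *\<^sub>R 1 - a)"
proof (cases "a = 0")
  case True
  then show ?thesis using assms by (simp add: pos_scaleR_one)
next
  case False
  then have t: "t > 0" using assms by (metis less_le_trans zero_less_norm_iff)
  then show ?thesis
    using assms by (intro posI[of _ t]) (auto simp: pos_sa)
qed

text \<open>If \<open>k\<close> is the root of \<open>a * (t - a)\<close>, then
  \<open>a - t/2\<close> and \<open>k\<close> have squares summing to \<open>(t/2)\<^sup>2\<close>;
  hence \<open>a\<close> is within \<open>t/2\<close> of \<open>t/2\<close>.\<close>

lemma norm_le_of_pos_diff:
  assumes "pos a" "pos (t *\<^sub>R 1 - a)" "t \<ge> 0"
  shows "norm a \<le> t"
proof -
  have "a * (t *\<^sub>R 1 - a) = (t *\<^sub>R 1 - a) * a" by (simp add: algebra_simps)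
  then have "pos (a * (t *\<^sub>R 1 - a))"
    by (rule pos_mult_commuting[OF assms(1,2)])
  then obtain k where k: "pos k" "k * k = a * (t *\<^sub>R 1 - a)"
    "\<And>w. w * (a * (t *\<^sub>R 1 - a)) = a * (t *\<^sub>R 1 - a) * w \<Longrightarrow> w * k = k * w"
    using pos_root_exists by meson
  define d where "d = a - (t/2) *\<^sub>R 1"
  have "a * k = k * a" by (rule k(3)) (simp add: algebra_simps)
  then have "d * k = k * d" by (simp add: d_def algebra_simps)
  moreover have "d * d + k * k = (t/2)\<^sup>2 *\<^sub>R 1"
    unfolding k d_def by (simp add: algebra_simps power2_eq_square flip: scaleR_add_left)
  ultimately have "norm d \<le> t/2"
    using norm_le_of_sum_squares[of d k "t/2"] assms k(1) by (simp add: d_def pos_sa)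
  moreover have "norm a \<le> norm d + norm ((t/2) *\<^sub>R (1::'b))"
    using norm_triangle_ineq[of d "(t/2) *\<^sub>R 1"] by (simp add: d_def)
  ultimately show ?thesis
    using norm_scaleR_one_le[of "t/2"] assms(3) by simp
qed

lemma norm_mono:
  assumes "pos a" "pos (b - a)"
  shows "norm a \<le> norm b"
proof -
  have b: "pos b" using pos_add[OF assms] by simp
  have "pos ((norm b *\<^sub>R 1 - b) + (b - a))"
    by (intro pos_add pos_norm_diff b order_refl assms)
  then show ?thesis
    using assms by (intro norm_le_of_pos_diff) auto
qed

lemma pos_antisym: "pos a \<Longrightarrow> pos (- a) \<Longrightarrow> a = 0"
  using norm_mono[of a 0] by simp

lemma pos_conj_commuting:
  assumes "pos r" "sa e" "r * e = e * r"
  shows "pos (e * r * e)"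
proof -
  obtain y where y: "pos y" "y * y = r" "\<And>w. w * r = r * w \<Longrightarrow> w * y = y * w"
    using pos_root_exists[OF assms(1)] by blast
  have ey: "e * y = y * e" using y(3)[of e] assms by simp
  then have "pos ((e * y) * (e * y))"
    using assms y(1) ey by (intro pos_sq sa_mult) (auto simp: pos_sa)
  moreover have "(e * y) * (e * y) = e * r * e"
    using ey y(2) by (metis mult.assoc)
  ultimately show ?thesis by simp
qed

text \<open>Two given roots need not commute a priori, so each is compared with the root
  \<open>r\<close> that commutes with everything commuting with the square. For
  \<open>e = r - y\<close> the positive elements \<open>e * r * e\<close> and
  \<open>e * y * e\<close> sum to zero, so both vanish and \<open>e * e * e = 0\<close>.\<close>

lemma pos_root_unique:
  assumes "pos y" "pos z" "y * y = z * z"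
  shows "y = z"
proof -
  have "y = r" if r: "pos r" "r * r = y * y" "r * y = y * r" and y: "pos y" for r y
  proof -
    define e where "e = r - y"
    have e: "sa e" using r y by (simp add: e_def pos_sa)
    have c: "r * e = e * r" "y * e = e * y"
      using r by (simp_all add: e_def algebra_simps)
    have p: "pos (e * r * e)" "pos (e * y * e)"
      using pos_conj_commuting[OF r(1) e c(1)] pos_conj_commuting[OF y e c(2)] by auto
    have "e * (r + y) = 0"
      using r by (simp add: e_def algebra_simps)
    then have "e * (r + y) * e = 0" by simp
    then have sum: "e * r * e + e * y * e = 0"
      by (simp add: algebra_simps)
    then have "- (e * r * e) = e * y * e" by (metis add.inverse_unique)
    then have 0: "e * r * e = 0"
      using pos_antisym[OF p(1)] p(2) by simp
    then have "e * y * e = 0" using sum by (simp only: add_0_left)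
    moreover have "e * e * e = e * r * e - e * y * e"
      by (subst (2) e_def) (simp add: algebra_simps)
    ultimately have "e * e * e = 0"
      using 0 by (simp only: diff_self)
    then have "(e * e) * (e * e) = 0" by (metis mult.assoc mult_zero_left)
    then have "e * e = 0" by (rule sa_sq_zero[OF sa_mult[OF e e refl]])
    then have "e = 0" using e sa_sq_zero by blast
    then show ?thesis by (simp add: e_def)
  qed
  note * = this
  obtain r where r: "pos r" "r * r = y * y" "\<And>w. w * (y * y) = (y * y) * w \<Longrightarrow> w * r = r * w"
    using pos_root_exists[OF pos_sq[OF pos_sa[OF assms(1)]]] by blast
  have "r * y = y * r" using r(3)[of y] by (simp add: mult.assoc)
  moreover have "r * z = z * r" using r(3)[of z] assms(3) by (simp add: mult.assoc)
  ultimately have "y = r" "z = r"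
    using *[OF r(1,2) _ assms(1)] *[OF r(1) r(2)[unfolded assms(3)] _ assms(2)] by blast+
  then show ?thesis by simp
qed

definition psqrt :: "'b \<Rightarrow> 'b" where
  "psqrt a = (THE y. pos y \<and> y * y = a)"

lemma psqrt_eq: "pos y \<Longrightarrow> y * y = a \<Longrightarrow> psqrt a = y"
  unfolding psqrt_def by (rule the_equality) (auto intro: pos_root_unique)

lemma psqrt:
  assumes "pos a"
  shows "pos (psqrt a)" "psqrt a * psqrt a = a"
proof -
  obtain y where "pos y" "y * y = a"
    using pos_root_exists[OF assms] by blast
  then show "pos (psqrt a)" "psqrt a * psqrt a = a"
    using psqrt_eq[of y a] by simp_all
qed

text \<open>With a common scale \<open>r\<close>, both roots are values of the same power
  series.\<close>

lemma psqrt_intertwine: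
  assumes "pos a" "pos b" "w * a = b * w"
  shows "w * psqrt a = psqrt b * w"
proof -
  obtain s t where st: "s > 0" "t > 0" "norm (s *\<^sub>R 1 - a) \<le> s" "norm (t *\<^sub>R 1 - b) \<le> t"
    using assms unfolding pos_def by blast
  define r where "r = max s t"
  have r: "r > 0" "norm (r *\<^sub>R 1 - a) \<le> r" "norm (r *\<^sub>R 1 - b) \<le> r"
    using st norm_shift_mono[of s a r] norm_shift_mono[of t b r] by (auto simp: r_def)
  have "psqrt a = scaled_rt r a" "psqrt b = scaled_rt r b"
    using r assms by (auto intro!: psqrt_eq pos_scaled_rt scaled_rt_sq simp: pos_sa)
  then show ?thesis
    using scaled_rt_intertwine[OF r assms(3)] by simp
qed

lemma psqrt_commute: "pos a \<Longrightarrow> w * a = a * w \<Longrightarrow> w * psqrt a = psqrt a * w"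
  using psqrt_intertwine by blast

text \<open>
  For Fukamiya's theorem below: with \<open>v\<close> twice the negative part of \<open>a = st x * x\<close>, the element \<open>w = x * v\<close>
  has \<open>- (st w * w)\<close> and \<open>w * st w\<close> both positive; as \<open>w\<close> intertwines them up to sign, comparing the
  square roots of their squares gives \<open>st w * w = 0\<close>.
\<close>

lemma pos_st_mult_neg:
  assumes w: "w \<in> M" and p: "pos (- (st w * w))"
  shows "w = 0"
proof -
  define q where "q = w * st w"
  define p' where "p' = - (st w * w)"
  \<comment> \<open>The real and imaginary parts of \<open>w\<close>, with \<open>J\<close> as the
    imaginary unit. Positivity of \<open>q\<close> follows from
    \<open>st w * w + w * st w = 2 * (re * re + im * im)\<close>.\<close>
  define re im where "re = (1/2) *\<^sub>R (w + st w)" and "im = (1/2) *\<^sub>R (J * (st w - w))"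
  have sa: "sa re" "sa im"
    using w by (auto intro!: saI simp: re_def im_def add.commute J_comm algebra_simps)
  have JJ: "J * x * (J * y) = - (x * y)" if "x \<in> M" for x y
    by (metis J_J J_comm minus_mult_left mult.assoc mult.left_neutral that)
  have "4 *\<^sub>R (im * im) = J * (st w - w) * (J * (st w - w))"
    by (simp add: im_def)
  also have "\<dots> = - ((st w - w) * (st w - w))"
    using w by (simp add: JJ)
  finally have im: "4 *\<^sub>R (im * im) = - ((st w - w) * (st w - w))" .
  have "4 *\<^sub>R (re * re) = (w + st w) * (w + st w)"
    by (simp add: re_def)
  then have "4 *\<^sub>R (re * re) + 4 *\<^sub>R (im * im) = 2 *\<^sub>R (st w * w) + 2 *\<^sub>R q"
    unfolding im by (simp add: q_def algebra_simps scaleR_2)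
  then have "2 *\<^sub>R q = 4 *\<^sub>R (re * re) + 4 *\<^sub>R (im * im) - 2 *\<^sub>R (st w * w)"
    by simp
  also have "\<dots> = 2 *\<^sub>R (2 *\<^sub>R (re * re) + 2 *\<^sub>R (im * im) + p')"
    by (simp add: p'_def scaleR_diff_right scaleR_add_right)
  finally have "q = 2 *\<^sub>R (re * re) + 2 *\<^sub>R (im * im) + p'"
    by (simp only: scaleR_cancel_left) simp
  moreover have p': "pos p'" using p by (simp add: p'_def)
  ultimately have q: "pos q"
    using sa by (auto intro!: pos_add pos_scaleR pos_sq)
  have wp: "w * p' = - (q * w)"
    by (simp add: p'_def q_def mult.assoc)
  then have "w * (p' * p') = (q * q) * w"
    by (metis minus_mult_right minus_mult_left mult.assoc add.inverse_inverse)
  then have "w * psqrt (p' * p') = psqrt (q * q) * w"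
    using p' q by (intro psqrt_intertwine pos_sq) (auto simp: pos_sa)
  then have "w * p' = q * w"
    using p' q psqrt_eq[of p'] psqrt_eq[of q] by auto
  then have "w * p' = 0"
  proof -
    have "2 *\<^sub>R (w * p') = w * p' - q * w"
      using wp by (simp add: scaleR_2)
    then show ?thesis
      using \<open>w * p' = q * w\<close> by simp
  qed
  then have "p' * p' = 0"
    by (simp add: p'_def[of] mult.assoc)
  then have "p' = 0" using p' sa_sq_zero pos_sa by blast
  then show ?thesis
    using eq_zero_if_st_mult_zero[OF w] by (simp add: p'_def)
qed

lemma pos_st_mult:
  assumes x: "x \<in> M"
  shows "pos (st x * x)"
proof -
  define a where "a = st x * x"
  have a: "sa a" using x by (simp add: a_def)
  define h where "h = psqrt (a * a)"
  have h: "pos h" "h * h = a * a"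
    using psqrt[OF pos_sq[OF a]] by (auto simp: h_def)
  have ah: "a * h = h * a"
    unfolding h_def by (rule psqrt_commute[OF pos_sq[OF a]]) (simp add: mult.assoc)
  define v where "v = h - a"
  \<comment> \<open>Chosen so that \<open>g * g = h * v * v = - (v * a * v)\<close>, which exhibits
    the negated element as a square.\<close>
  define g where "g = psqrt h * v"
  have v: "sa v" using a h by (simp add: v_def pos_sa)
  have r: "pos (psqrt h)" "psqrt h * psqrt h = h" using psqrt[OF h(1)] by auto
  have hv: "v * h = h * v" by (simp add: v_def algebra_simps ah)
  have rv: "v * psqrt h = psqrt h * v"
    by (rule psqrt_commute[OF h(1) hv])
  have g: "sa g"
    unfolding g_def using r v rv by (intro sa_mult) (auto simp: pos_sa)
  have gg: "g * g = h * v * v"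
    unfolding g_def by (metis rv r(2) mult.assoc)
  have av: "a * v = - (h * v)"
    by (simp add: v_def algebra_simps ah h(2))
  have "v * a = a * v" by (simp add: v_def algebra_simps ah)
  then have "v * a * v = - (h * v * v)"
    by (simp add: av)
  then have "- (st (x * v) * (x * v)) = g * g"
    using x v by (simp add: gg a_def mult.assoc)
  then have "x * v = 0"
    using x v pos_sq[OF g] by (intro pos_st_mult_neg) auto
  then have "a * v = 0" by (simp add: a_def mult.assoc)
  then have "h * v = 0" using av by simp
  then have "v * v = 0" using \<open>a * v = 0\<close> by (subst v_def) (simp add: left_diff_distrib)
  then have "v = 0" using v sa_sq_zero by blast
  then show ?thesis using h by (simp add: v_def a_def)
qed

lemma pos_conj:
  assumes "pos a" "x \<in> M"
  shows "pos (st x * a * x)"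
proof -
  have "pos (st (psqrt a * x) * (psqrt a * x))"
    using psqrt[OF assms(1)] assms(2) by (intro pos_st_mult) auto
  moreover have "st (psqrt a * x) * (psqrt a * x) = st x * (psqrt a * psqrt a) * x"
    using psqrt(1)[OF assms(1)] assms(2) by (simp add: mult.assoc)
  ultimately show ?thesis
    by (simp only: psqrt(2)[OF assms(1)])
qed

section \<open>Positive commutators\<close>

lemma pos_power: "pos p \<Longrightarrow> pos (p ^ n)"
proof (induction n)
  case 0
  show ?case using pos_scaleR_one[of 1] by simp
next
  case (Suc n)
  then show ?case
    using pos_mult_commuting[of p "p ^ n"] by (simp add: power_commutes)
qed

text \<open>On [0, 1], \<open>1 - p ^ (m + 1)\<close> is \<open>1 - p\<close> times a sum of
  \<open>m + 1\<close> powers, each at least \<open>p ^ m\<close>. The induction adds a positive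
  multiple of \<open>p ^ m * (1 - p) * (1 - p)\<close> at each step.\<close>

lemma pos_power_gap:
  assumes p: "pos p" and np: "norm p \<le> 1"
  shows "real (Suc m) * norm (p ^ m * (1 - p)) \<le> 1"
proof -
  have p1: "pos (1 - p)" using pos_norm_diff[OF p np] by simp
  have pm: "pos (p ^ m * (1 - p))" for m
    by (rule pos_mult_commuting[OF pos_power[OF p] p1])
      (simp add: left_diff_distrib right_diff_distrib power_commutes)
  have pm2: "pos (p ^ m * (1 - p) * (1 - p))" for m
    by (rule pos_mult_commuting[OF pm p1])
      (simp add: left_diff_distrib right_diff_distrib power_commutes mult.assoc)
  have "pos (1 - p ^ Suc m - real (Suc m) *\<^sub>R (p ^ m * (1 - p)))"
  proof (induction m)
    case (Suc m)
    have "1 - p ^ Suc (Suc m) - real (Suc (Suc m)) *\<^sub>R (p ^ Suc m * (1 - p))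
      = 1 - p ^ Suc m - real (Suc m) *\<^sub>R (p ^ m * (1 - p)) + real (Suc m) *\<^sub>R (p ^ m * (1 - p) * (1 - p))"
      by (simp add: left_diff_distrib right_diff_distrib power_commutes mult.assoc scaleR_left_distrib scaleR_diff_right)
        (simp add: algebra_simps scaleR_2)
    moreover have "pos (1 - p ^ Suc m - real (Suc m) *\<^sub>R (p ^ m * (1 - p))
        + real (Suc m) *\<^sub>R (p ^ m * (1 - p) * (1 - p)))"
      by (intro pos_add Suc pos_scaleR pm2) simp
    ultimately show ?case by (simp only:)
  qed simp
  from pos_add[OF this pos_power[OF p, of "Suc m"]]
  have "pos (1 *\<^sub>R 1 - real (Suc m) *\<^sub>R (p ^ m * (1 - p)))" by (simp add: algebra_simps)
  then have "norm (real (Suc m) *\<^sub>R (p ^ m * (1 - p))) \<le> 1"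
    by (intro norm_le_of_pos_diff pos_scaleR pm) auto
  then show ?thesis by simp
qed

text \<open>Iterated squaring reaches exponents that are powers of two, which dictates the choice of
  \<open>n\<close> in the commutator argument.\<close>

lemma norm_sa_pow2: "sa x \<Longrightarrow> norm (x ^ (2 ^ k)) = norm x ^ (2 ^ k)"
proof (induction k)
  case (Suc k)
  have "x ^ (2 ^ Suc k) = x ^ (2 ^ k) * x ^ (2 ^ k)"
    by (simp add: mult_2 flip: power_add)
  then have "norm (x ^ (2 ^ Suc k)) = (norm (x ^ (2 ^ k)))\<^sup>2"
    using Suc.prems norm_sa_sq[of "x ^ (2 ^ k)"] by simp
  also have "\<dots> = norm x ^ (2 ^ Suc k)"
    using Suc by (simp add: power_mult[symmetric] mult.commute)
  finally show ?case .
qed simp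

lemma norm_J_le: "norm J \<le> 1"
proof -
  have "(norm J)\<^sup>2 \<le> 1\<^sup>2" using cstar[of J] J_J norm_one_le by simp
  then show ?thesis by (rule power2_le_imp_le) simp
qed

text \<open>In \<open>w * (Q * S - S * Q) * w\<close> replace \<open>S * w\<close> by
  \<open>e *\<^sub>R w + r\<close>: the terms with \<open>e\<close> cancel, and only those with the
  error \<open>r\<close> remain.\<close>

lemma commutator_approx:
  assumes S: "sa S" and Q: "Q \<in> M" and c: "c > 0"
    and p: "pos (J * (Q * S - S * Q) - c *\<^sub>R (S * S))"
    and w: "sa w" "w * S = S * w" "norm w \<le> 2" and \<delta>: "norm (S * w - e *\<^sub>R w) \<le> \<delta>"
  shows "c * (norm (S * w))\<^sup>2 \<le> 4 * norm Q * \<delta>"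
proof -
  define T where "T = J * (Q * S - S * Q)"
  define r where "r = S * w - e *\<^sub>R w"
  have M: "S \<in> M" "w \<in> M" using S w by auto
  have wJ: "w * (J * x) = J * (w * x)" for x
    using J_comm[OF M(2)] by (metis mult.assoc)
  have wT: "w * T * w = J * (w * Q * r - r * Q * w)"
    unfolding T_def r_def
    by (simp add: mult.assoc wJ right_diff_distrib left_diff_distrib w(2)[THEN mult_assoc_ext])
  have sSw: "sa (S * w)" using S w by (simp add: sa_mult)
  have "w * (T - c *\<^sub>R (S * S)) * w = w * T * w - c *\<^sub>R ((S * w) * (S * w))"
    by (simp add: mult.assoc right_diff_distrib left_diff_distrib w(2)[THEN mult_assoc_ext])
  moreover have "pos (w * (T - c *\<^sub>R (S * S)) * w)"
    using pos_conj[OF p M(2)] w by (simp add: T_def)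
  ultimately have "norm (c *\<^sub>R ((S * w) * (S * w))) \<le> norm (w * T * w)"
    using c by (intro norm_mono pos_scaleR pos_sq sSw) auto
  then have "c * (norm (S * w))\<^sup>2 \<le> norm (w * T * w)"
    using c norm_sa_sq[OF sSw] by simp
  also have "\<dots> \<le> norm J * norm (w * Q * r - r * Q * w)"
    unfolding wT by (rule norm_mult_ineq)
  also have "\<dots> \<le> 1 * norm (w * Q * r - r * Q * w)"
    by (intro mult_right_mono norm_J_le) auto
  also have "\<dots> \<le> norm (w * Q * r) + norm (r * Q * w)"
    using norm_triangle_ineq4 by simp
  also have "\<dots> \<le> norm w * norm Q * norm r + norm r * norm Q * norm w"
    by (intro add_mono order_trans[OF norm_mult_ineq] mult_right_mono norm_mult_ineq) auto
  also have "\<dots> = 2 * (norm w * (norm Q * norm r))" by simp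
  also have "\<dots> \<le> 2 * (2 * (norm Q * \<delta>))"
    using w \<delta> by (intro mult_left_mono mult_mono) (auto simp: r_def)
  finally show ?thesis by simp
qed

text \<open>
  A commutator \<open>i[Q, S]\<close> cannot dominate \<open>c S\<^sup>2\<close>: compress by approximate eigenvectors of \<open>S\<close> for
  its eigenvalues \<open>\<plusminus> norm S\<close>, where the commutator almost vanishes. The approximate spectral
  projections are \<open>S ^ (2 * n) * (1 \<plusminus> S)\<close>.
\<close>

lemma commutator_pos_zero_aux:
  assumes S: "sa S" "norm S = 1" and Q: "Q \<in> M" and c: "c > 0"
    and p: "pos (J * (Q * S - S * Q) - c *\<^sub>R (S * S))"
  shows False
proof -
  define p where "p = S * S"
  have pp: "pos p" "norm p = 1" using S by (auto simp: p_def pos_sq norm_sa_sq)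
  \<comment> \<open>Large enough that \<open>\<delta> < 1/2\<close> and that
    \<open>commutator_approx\<close> yields \<open>norm (S * w) \<le> 1/2\<close>.\<close>
  obtain k where k: "real k > 16 * norm Q / c + 2"
    using reals_Archimedean2 by blast
  define n where "n = (2::nat) ^ k"
  define \<delta> where "\<delta> = 1 / real (Suc n)"
  have n: "real (Suc n) > 16 * norm Q / c + 2"
  proof -
    have "real k < 2 ^ k" by (rule of_nat_less_two_power)
    moreover have "real (Suc n) = 2 ^ k + 1" by (simp add: n_def)
    ultimately show ?thesis using k by linarith
  qed
  have q0: "16 * norm Q / c \<ge> 0" using c by simp
  have \<delta>: "\<delta> < 1/2" "4 * norm Q * \<delta> \<le> c * (1/2)\<^sup>2"
  proof -
    show "\<delta> < 1/2" using n q0 by (simp add: \<delta>_def field_simps)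
    have "16 * norm Q / c \<le> real (Suc n)" using n by linarith
    then have "16 * norm Q \<le> c * real (Suc n)" using c by (simp add: field_simps)
    then show "4 * norm Q * \<delta> \<le> c * (1/2)\<^sup>2"
      by (simp add: \<delta>_def power2_eq_square field_simps)
  qed
  have gap: "norm (p ^ n * (1 - p)) \<le> \<delta>"
    using pos_power_gap[of p n] pp by (simp add: \<delta>_def field_simps)
  have pS: "p * S = S * p" by (simp add: p_def mult.assoc)
  have pnS: "p ^ n * S = S * p ^ n" by (rule power_commuting_commutes) (rule pS)
  \<comment> \<open>Since \<open>S * w\<close> is within \<open>\<delta>\<close> of
    \<open>e *\<^sub>R w\<close>, smallness of \<open>S * w\<close> forces smallness of
    \<open>w\<close> itself.\<close>
  have key: "norm (p ^ n * (1 + e *\<^sub>R S)) < 1" if e: "e = 1 \<or> e = -1" for e :: real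
  proof -
    define w where "w = p ^ n * (1 + e *\<^sub>R S)"
    have sw: "sa w" unfolding w_def
      using S pp pnS by (intro sa_mult) (auto simp: pos_sa distrib_left distrib_right)
    have ws: "w * S = S * w"
      unfolding w_def by (simp add: distrib_left distrib_right mult.assoc pnS pnS[THEN mult_assoc_ext])
    have "norm w \<le> norm (p ^ n) * norm (1 + e *\<^sub>R S)"
      unfolding w_def by (rule norm_mult_ineq)
    also have "\<dots> \<le> 1 * 2"
    proof (intro mult_mono)
      show "norm (p ^ n) \<le> 1" using pp by (intro norm_power_le_one) auto
      have "norm (1 + e *\<^sub>R S) \<le> norm (1::'b) + norm (e *\<^sub>R S)" by (rule norm_triangle_ineq)
      then show "norm (1 + e *\<^sub>R S) \<le> 2" using norm_one_le S e by auto
    qed auto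
    finally have nw: "norm w \<le> 2" by simp
    have "S * w - e *\<^sub>R w = - (e *\<^sub>R (p ^ n * (1 - p)))"
      using e unfolding w_def
      by (auto simp: distrib_left distrib_right right_diff_distrib mult.assoc
          pnS[symmetric] pnS[symmetric, THEN mult_assoc_ext] p_def[symmetric])
    then have d: "norm (S * w - e *\<^sub>R w) \<le> \<delta>"
      using gap e by auto
    have "c * (norm (S * w))\<^sup>2 \<le> c * (1/2)\<^sup>2"
      using commutator_approx[OF S(1) Q c p sw ws nw d] \<delta> by linarith
    then have "(norm (S * w))\<^sup>2 \<le> (1/2)\<^sup>2"
      using c by (simp only: mult_le_cancel_left_pos)
    then have Sw: "norm (S * w) \<le> 1/2"
      by (rule power2_le_imp_le) simp
    have "norm w = norm (e *\<^sub>R w)" using e by auto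
    also have "\<dots> \<le> norm (S * w) + norm (S * w - e *\<^sub>R w)"
      by (metis norm_minus_commute norm_triangle_sub)
    finally show ?thesis using Sw d \<delta> unfolding w_def by linarith
  qed
  \<comment> \<open>The contradiction: \<open>p ^ n\<close> has norm 1, yet it is the mean of the
    two approximate projections, both of norm below 1.\<close>
  have "norm (p ^ n) = 1"
    using norm_sa_pow2[of p k] pp by (simp add: n_def pos_sa)
  moreover have "2 * norm (p ^ n) \<le> norm (p ^ n * (1 + 1 *\<^sub>R S)) + norm (p ^ n * (1 + (-1) *\<^sub>R S))"
  proof -
    have "2 *\<^sub>R p ^ n = p ^ n * (1 + 1 *\<^sub>R S) + p ^ n * (1 + (-1) *\<^sub>R S)"
      by (simp add: distrib_left scaleR_2 right_diff_distrib)
    then have "norm (2 *\<^sub>R p ^ n) \<le> norm (p ^ n * (1 + 1 *\<^sub>R S)) + norm (p ^ n * (1 + (-1) *\<^sub>R S))"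
      by (simp only: norm_triangle_ineq)
    then show ?thesis by (simp only: norm_scaleR abs_numeral)
  qed
  ultimately show False using key[of 1] key[of "-1"] by linarith
qed

text \<open>Normalise \<open>S\<close>: the commutator is linear and \<open>S * S\<close> quadratic,
  so the constant becomes \<open>c * norm S\<close>.\<close>

lemma commutator_pos_zero:
  assumes S: "sa S" and Q: "Q \<in> M" and c: "c > 0"
    and p: "pos (J * (Q * S - S * Q) - c *\<^sub>R (S * S))"
  shows "S = 0"
proof (rule ccontr)
  assume "S \<noteq> 0"
  define s where "s = norm S"
  define S' where "S' = (1/s) *\<^sub>R S"
  have s: "s > 0" using \<open>S \<noteq> 0\<close> by (simp add: s_def)
  have "pos ((1/s) *\<^sub>R (J * (Q * S - S * Q) - c *\<^sub>R (S * S)))"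
    using s by (intro pos_scaleR p) auto
  also have "(1/s) *\<^sub>R (J * (Q * S - S * Q) - c *\<^sub>R (S * S)) = J * (Q * S' - S' * Q) - (c * s) *\<^sub>R (S' * S')"
    using s by (simp add: S'_def scaleR_diff_right right_diff_distrib)
  finally have "pos (J * (Q * S' - S' * Q) - (c * s) *\<^sub>R (S' * S'))" .
  moreover have "sa S'" "norm S' = 1" using S s by (auto simp: S'_def s_def)
  ultimately show False
    using commutator_pos_zero_aux[of S' Q "c * s"] Q c s by simp
qed

section \<open>The parallel sum under the triangle equality\<close>

text \<open>Polar decomposition inside the algebra. \<open>Y = X * st X\<close> is the Moore-Penrose
  inverse of \<open>st C * C\<close>, hence \<open>K = G * Y\<close> is that of \<open>G\<close>;
  \<open>E = X * C\<close> is the support projection and \<open>U = C * K\<close> the partial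
  isometry.\<close>

lemma polar_mp:
  assumes M: "C \<in> M" "X \<in> M"
    and mp: "C * X * C = C" "X * C * X = X" "st (C * X) = C * X" "st (X * C) = X * C"
    and G: "G = psqrt (st C * C)"
  obtains K U E where "pos K" "U \<in> M" "st U * U = E" "E * E = E" "U * E = U"
    "G * K = E" "K * G = E" "E * G = G" "G * E = G" "E * K = K" "K * E = K"
    "C = U * G" "X = K * st U"
proof -
  define E where "E = X * C"
  define Y where "Y = X * st X"
  define K where "K = G * Y"
  define U where "U = C * K"
  have pG: "pos G" and GG: "G * G = st C * C"
    using psqrt[OF pos_st_mult[OF M(1)]] G by auto
  have EM: "E \<in> M" "Y \<in> M" "K \<in> M" "U \<in> M" and stE: "st E = E" and stY: "st Y = Y"
    using M mp(4) pG by (auto simp: E_def Y_def K_def U_def)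
  have cx: "st X * st C = C * X" and xc: "st C * st X = X * C"
    using mp(3,4) M by auto
  note mm = mp(1,2)[unfolded mult.assoc] cx xc
  note ms = mm mm[THEN mult_assoc_ext, unfolded mult.assoc]
  have EE: "E * E = E" and EX: "E * X = X" and CE: "C * E = C"
    by (simp_all add: E_def ms mult.assoc)
  have EY: "E * Y = Y"
    by (simp add: Y_def EX flip: mult.assoc)
  have YE: "Y * E = Y"
    using arg_cong[OF EY, of st] EM stE stY by simp
  have HY: "st C * C * Y = E"
  proof -
    have "st C * C * Y = st C * (C * X) * st X" by (simp add: Y_def mult.assoc)
    also have "\<dots> = (st C * st X) * (st C * st X)" by (simp add: cx[symmetric] mult.assoc)
    also have "\<dots> = E" using EE by (simp add: xc E_def)
    finally show ?thesis .
  qed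
  have YH: "Y * (st C * C) = E"
    using arg_cong[OF HY, of st] EM stE stY M by (simp add: mult.assoc)
  have YG: "Y * G = G * Y"
    unfolding G by (rule psqrt_commute[OF pos_st_mult[OF M(1)]]) (simp add: HY YH)
  have GK: "G * K = E"
    using HY by (simp add: K_def GG flip: mult.assoc)
  have KG: "K * G = E"
    using YH by (simp add: K_def mult.assoc YG GG[symmetric]) (metis YG mult.assoc)
  have HE: "G * G * E = G * G"
    unfolding GG mult.assoc CE by simp
  have GE: "G * E = G"
  proof -
    have "st (G - G * E) * (G - G * E) = (G * G - G * G * E) - E * (G * G - G * G * E)"
      using pG EM stE by (simp add: left_diff_distrib right_diff_distrib mult.assoc)
    also have "\<dots> = 0" unfolding HE by simp
    finally have "G - G * E = 0"
      by (rule eq_zero_if_st_mult_zero[rotated]) (intro diff_M mult_M pos_M[OF pG] EM)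
    then show ?thesis by simp
  qed
  have EG: "E * G = G"
    using arg_cong[OF GE, of st] EM stE pG by simp
  have KE: "K * E = K" by (simp add: K_def mult.assoc YE)
  have EK: "E * K = K" by (simp add: K_def EG flip: mult.assoc)
  have stK: "st K = K" using EM pG stY by (simp add: K_def YG)
  have KK: "K * K = Y"
  proof -
    have "K * K = (K * G) * Y" by (simp add: K_def mult.assoc)
    then show ?thesis by (simp add: KG EY)
  qed
  have pK: "pos K"
  proof -
    define r where "r = psqrt G"
    have r: "pos r" "r * r = G" using psqrt[OF pG] by (auto simp: r_def)
    have "Y * r = r * Y" unfolding r_def by (rule psqrt_commute[OF pG YG])
    \<comment> \<open>Split \<open>G\<close> as \<open>r * r\<close> and move one factor past
      \<open>Y\<close>, giving \<open>K = r * X * st X * r\<close>.\<close>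
    then have "K = st (st X * r) * (st X * r)"
      using M r(1) by (simp add: K_def r(2)[symmetric] Y_def mult.assoc)
    then show ?thesis using pos_st_mult[of "st X * r"] M r(1) by simp
  qed
  have stU: "st U = K * st C" using M EM by (simp add: U_def stK)
  have UU: "st U * U = E"
  proof -
    have "st U * U = K * (G * G) * K" by (simp add: stU GG mult.assoc) (simp add: U_def mult.assoc)
    also have "\<dots> = (K * G) * (G * K)" by (simp add: mult.assoc)
    finally show ?thesis by (simp add: KG GK EE)
  qed
  have UE: "U * E = U" by (simp add: U_def mult.assoc KE)
  have UG: "C = U * G" by (simp add: U_def mult.assoc KG CE)
  have XU: "X = K * st U"
  proof -
    have "K * st U = Y * st C" by (simp add: stU KK flip: mult.assoc)
    also have "\<dots> = X" using ms by (simp add: Y_def mult.assoc)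
    finally show ?thesis by simp
  qed
  show thesis
    by (rule that[of K U E]) (fact pK EM UU EE UE GK KG EG GE EK KE UG XU)+
qed

text \<open>Compression by \<open>1 - E\<close> turns \<open>P\<close> and \<open>Q\<close> into
  positive elements with sum zero, so both vanish; then the root of \<open>P\<close> annihilates
  \<open>1 - E\<close>.\<close>

lemma pos_sum_support:
  assumes "pos P" "pos Q" "E \<in> M" "st E = E" "(P + Q) * E = P + Q"
  shows "P * E = P"
proof -
  have e: "st (1 - E) = 1 - E" "1 - E \<in> M" using assms by auto
  have p: "pos ((1 - E) * P * (1 - E))" "pos ((1 - E) * Q * (1 - E))"
    using pos_conj[OF assms(1) e(2)] pos_conj[OF assms(2) e(2)] e by simp_all
  have "(1 - E) * P * (1 - E) + (1 - E) * Q * (1 - E) = (1 - E) * ((P + Q) - (P + Q) * E)"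
    by (simp add: algebra_simps)
  also have "\<dots> = 0" unfolding assms(5) by simp
  finally have "- ((1 - E) * P * (1 - E)) = (1 - E) * Q * (1 - E)"
    by (rule minus_unique)
  then have 0: "(1 - E) * P * (1 - E) = 0"
    using pos_antisym[OF p(1)] p(2) by simp
  define r where "r = psqrt P"
  have r: "pos r" "r * r = P" using psqrt[OF assms(1)] by (auto simp: r_def)
  have "st (r * (1 - E)) * (r * (1 - E)) = (1 - E) * P * (1 - E)"
    using r(1) e by (simp add: r(2)[symmetric] mult.assoc)
  then have "r * (1 - E) = 0"
    using eq_zero_if_st_mult_zero[of "r * (1 - E)"] r(1) e 0 by simp
  then have "r * (r * (1 - E)) = 0" by simp
  then have "P * (1 - E) = 0" by (simp add: r(2) flip: mult.assoc)
  then show ?thesis by (simp add: right_diff_distrib)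
qed

text \<open>
  With \<open>Z = st U * A - P\<close>, the hypotheses make \<open>G * Z\<close> skew-adjoint, say \<open>J * S\<close>, and compressing
  by \<open>L = psqrt K\<close> turns \<open>Q * Z + st Z * Q \<ge> st Z * Z\<close> into a commutator estimate for \<open>L * S * L\<close>.
\<close>

lemma triangle_equality_polar:
  assumes P: "pos P" and Q: "pos Q" and A: "A \<in> M" "st A * A = P * P" and B: "B \<in> M" "st B * B = Q * Q"
    and G: "G = P + Q" and U: "U \<in> M" "st U * U = E" "E * E = E" "U * E = U"
    and K: "pos K" "G * K = E" "K * G = E" "E * G = G" "G * E = G" "E * K = K" "K * E = K"
    and AB: "A + B = U * G"
  shows "A = U * P" "B = U * Q" "P * E = P" "Q * E = Q"
proof -
  have E: "E \<in> M" "st E = E" using U by auto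
  show PE: "P * E = P" and QE: "Q * E = Q"
    using pos_sum_support[OF P Q E] pos_sum_support[OF Q P E] K(5)
    by (simp_all add: G add.commute)
  have EP: "E * P = P" using arg_cong[OF PE, of st] E P by simp
  have EU: "E * st U = st U" using arg_cong[OF U(4), of st] E U(1) by simp
  have AE: "A * E = A"
  proof -
    have "st (A - A * E) * (A - A * E) = (st A * A - st A * A * E) - E * (st A * A - st A * A * E)"
      using A(1) E by (simp add: left_diff_distrib right_diff_distrib mult.assoc)
    also have "\<dots> = 0" unfolding A by (simp add: PE mult.assoc)
    finally have "A - A * E = 0"
      by (rule eq_zero_if_st_mult_zero[rotated]) (intro diff_M mult_M A E)
    then show ?thesis by simp
  qed
  have GM: "G \<in> M" "st G = G" "pos G" using P Q by (auto simp: G pos_add)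
  have KM: "K \<in> M" "st K = K" using K by auto
  have PM: "P \<in> M" "Q \<in> M" "st P = P" "st Q = Q" using P Q by auto
  define Z where "Z = st U * A - P"
  have ZM: "Z \<in> M" using U A P by (simp add: Z_def)
  have UA: "st U * A = P + Z" by (simp add: Z_def)
  have UB: "st U * B = Q - Z"
  proof -
    have "st U * A + st U * B = st U * U * G" using AB by (metis distrib_left mult.assoc)
    also have "\<dots> = P + Q" by (simp only: U(2) K(4) flip: G)
    finally show ?thesis by (simp add: Z_def algebra_simps)
  qed
  \<comment> \<open>The part of \<open>A\<close> outside the range of \<open>U\<close>. As
    \<open>U * st U\<close> fixes \<open>A + B\<close>, the corresponding part of \<open>B\<close>
    is \<open>- R\<close>, so \<open>A\<close> and \<open>B\<close> share the defect
    \<open>D = st R * R\<close>.\<close>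
  define R where "R = A - U * (st U * A)"
  have RM: "R \<in> M" using A U by (simp add: R_def)
  have UUU: "U * (st U * (U * x)) = U * x" for x
    by (metis U(2) U(4) mult.assoc)
  have RB: "R = - (B - U * (st U * B))"
  proof -
    have "U * (st U * A) + U * (st U * B) = A + B"
      unfolding distrib_left[symmetric] AB by (rule UUU)
    then show ?thesis by (simp add: R_def algebra_simps)
  qed
  define D where "D = st R * R"
  have stR_U: "st U * R = 0"
  proof -
    have "st U * R = st U * A - E * (st U * A)"
      by (simp add: R_def right_diff_distrib flip: U(2) mult.assoc)
    also have "E * (st U * A) = st U * A" by (simp add: EU flip: mult.assoc)
    finally show ?thesis by simp
  qed
  \<comment> \<open>Pythagoras for \<open>A = U * (st U * A) + R\<close>, using
    \<open>st U * A = P + Z\<close>.\<close>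
  have D1: "D = P * P - (P + st Z) * (P + Z)"
  proof -
    have "st R * U = 0" using arg_cong[OF stR_U, of st] RM U by simp
    then have "st R * (U * x) = 0" for x by (metis mult.assoc mult_zero_left)
    then have "D = st R * A" unfolding D_def by (subst (2) R_def) (simp add: right_diff_distrib)
    also have "st R = st A - st (st U * A) * st U" using A U by (simp add: R_def mult.assoc)
    also have "(st A - st (st U * A) * st U) * A = P * P - st (P + Z) * (P + Z)"
      by (simp only: left_diff_distrib A(2) mult.assoc UA)
    finally show ?thesis using PM ZM by simp
  qed
  have D2: "D = Q * Q - (Q - st Z) * (Q - Z)"
  proof -
    have "st R * U = 0" using arg_cong[OF stR_U, of st] RM U by simp
    then have "st R * (U * x) = 0" for x by (metis mult.assoc mult_zero_left)
    then have "D = - (st R * B)" unfolding D_def by (subst (2) RB) (simp add: right_diff_distrib)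
    also have "st R = - (st B - st (st U * B) * st U)" using B U by (simp add: RB mult.assoc)
    also have "- (- (st B - st (st U * B) * st U) * B) = Q * Q - st (Q - Z) * (Q - Z)"
      by (simp only: left_diff_distrib B(2) mult.assoc UB minus_mult_left[symmetric] minus_minus)
    finally show ?thesis using PM ZM by simp
  qed
  \<comment> \<open>Equate the two expressions for \<open>D\<close>; the terms
    \<open>st Z * Z\<close> cancel.\<close>
  have skew: "G * Z + st Z * G = 0"
  proof -
    have "G * Z + st Z * G = (Q * Q - (Q - st Z) * (Q - Z)) - (P * P - (P + st Z) * (P + Z))"
      by (simp add: G algebra_simps)
    then show ?thesis by (simp add: D1[symmetric] D2[symmetric])
  qed
  have D2': "Q * Z + st Z * Q - st Z * Z = D"
    unfolding D2 by (simp add: algebra_simps)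
  define S where "S = - (J * (G * Z))"
  have JJ: "J * (J * x) = - x" for x by (simp add: J_J flip: mult.assoc)
  have SM: "S \<in> M" using GM ZM by (simp add: S_def)
  have JS: "J * S = G * Z" by (simp add: S_def JJ)
  have sS: "sa S"
  proof (rule saI[OF SM])
    have "st S = st Z * G * J" using GM ZM by (simp add: S_def)
    also have "\<dots> = J * (st Z * G)" using GM ZM by (intro J_comm) auto
    also have "st Z * G = - (G * Z)" using skew by (metis minus_unique)
    finally show "st S = S" by (simp add: S_def)
  qed
  have EZ: "E * Z = Z" by (simp add: Z_def right_diff_distrib EP) (simp add: EU flip: mult.assoc)
  have ZE: "Z * E = Z" by (simp add: Z_def left_diff_distrib PE mult.assoc AE)
  have SE: "S * E = S" by (simp add: S_def mult.assoc ZE)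
  have ES: "E * S = S" using arg_cong[OF SE, of st] E sS by simp
  \<comment> \<open>\<open>K\<close> inverts \<open>G\<close> on the range of \<open>E\<close>, so
    \<open>Z\<close> is recovered from \<open>G * Z = J * S\<close>.\<close>
  have ZK: "Z = J * (K * S)"
  proof -
    have "J * (K * S) = K * (J * S)" using J_comm[OF KM(1)] by (metis mult.assoc)
    also have "\<dots> = Z" by (simp add: JS EZ K(3) flip: mult.assoc)
    finally show ?thesis by simp
  qed
  have stZ: "st Z = - (J * (S * K))"
  proof -
    have "st Z = - (S * K * J)" unfolding ZK using KM SM sS by (simp add: mult.assoc)
    then show ?thesis using J_comm[of "S * K"] KM SM by simp
  qed
  have comm: "J * (Q * K * S - S * K * Q) = S * K * K * S + D"
  proof -
    have c: "x * (J * y) = J * (x * y)" if "x \<in> M" for x y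
      using J_comm[OF that] by (metis mult.assoc)
    have "st Z * Z = S * K * K * S"
      unfolding stZ by (subst ZK) (simp add: mult.assoc c[OF SM] c[OF KM(1)] JJ)
    moreover have "Q * Z = J * (Q * K * S)"
      by (subst ZK) (simp add: c[OF PM(2)] mult.assoc)
    moreover have "st Z * Q = - (J * (S * K * Q))"
      by (simp add: stZ mult.assoc)
    ultimately show ?thesis using D2' by (simp add: algebra_simps)
  qed
  define L where "L = psqrt K"
  have L: "pos L" "L * L = K" using psqrt[OF K(1)] by (auto simp: L_def)
  have LM: "L \<in> M" "st L = L" using L by auto
  have LG: "G * L = L * G" and LE': "E * L = L * E"
    unfolding L_def by (rule psqrt_commute[OF K(1)]; simp add: K)+
  have LE: "L * E = L"
  proof -
    have "st (L - L * E) * (L - L * E) = (K - K * E) - E * (K - K * E)"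
      using LM E by (simp add: left_diff_distrib right_diff_distrib mult.assoc flip: L(2))
    also have "\<dots> = 0" by (simp add: K)
    finally have "L - L * E = 0"
      by (rule eq_zero_if_st_mult_zero[rotated]) (intro diff_M mult_M LM E)
    then show ?thesis by simp
  qed
  define S2 where "S2 = L * S * L"
  define Q2 where "Q2 = L * Q * L"
  have sS2: "sa S2" unfolding S2_def using LM SM sS by (intro saI) (auto simp: mult.assoc)
  have S2E: "S2 * E = S2" by (simp add: S2_def mult.assoc LE)
  \<comment> \<open>The summand 1 keeps \<open>t\<close> positive even if \<open>G = 0\<close>.
    Compressing \<open>t - G\<close> by \<open>L\<close> gives \<open>t *\<^sub>R K \<ge> E\<close>,
    hence \<open>S2 * K * S2\<close> dominates \<open>(1/t) *\<^sub>R (S2 * S2)\<close>.\<close>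
  define t where "t = norm G + 1"
  have t: "t > 0" by (simp add: t_def add_nonneg_pos)
  have "S2 = 0"
  proof (rule commutator_pos_zero[OF sS2])
    show "Q2 \<in> M" using LM PM by (simp add: Q2_def)
    show "1 / t > 0" using t by simp
    have LJ: "L * (J * x) = J * (L * x)" for x
      using J_comm[OF LM(1)] by (metis mult.assoc)
    have "J * (Q2 * S2 - S2 * Q2) = L * (J * (Q * K * S - S * K * Q)) * L"
      by (simp add: LJ mult.assoc S2_def Q2_def right_diff_distrib left_diff_distrib L(2)[THEN mult_assoc_ext])
    also have "\<dots> = S2 * K * S2 + L * D * L"
      unfolding comm by (simp add: S2_def distrib_left distrib_right mult.assoc flip: L(2))
    finally have 1: "J * (Q2 * S2 - S2 * Q2) = S2 * K * S2 + L * D * L" .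
    have "pos (S2 * (L * (t *\<^sub>R 1 - G) * L) * S2)"
      using pos_conj[OF pos_conj[OF pos_norm_diff[OF GM(3), of t] LM(1)], of S2] sS2 LM
      by (simp add: t_def)
    also have "L * (t *\<^sub>R 1 - G) * L = t *\<^sub>R K - E"
      by (simp add: left_diff_distrib right_diff_distrib L mult.assoc LG)
        (simp add: L(2)[THEN mult_assoc_ext] K)
    also have "S2 * (t *\<^sub>R K - E) * S2 = t *\<^sub>R (S2 * K * S2) - S2 * S2"
      by (simp add: right_diff_distrib left_diff_distrib S2E)
    finally have "pos (t *\<^sub>R (S2 * K * S2) - S2 * S2)" .
    then have "pos ((1/t) *\<^sub>R (t *\<^sub>R (S2 * K * S2) - S2 * S2))"
      using t by (intro pos_scaleR) auto
    then have 2: "pos (S2 * K * S2 - (1/t) *\<^sub>R (S2 * S2))"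
      using t by (simp add: scaleR_diff_right)
    have "pos (L * D * L)"
      using pos_conj[of D L] LM pos_st_mult[OF RM] by (simp add: D_def)
    from pos_add[OF 2 this]
    show "pos (J * (Q2 * S2 - S2 * Q2) - (1/t) *\<^sub>R (S2 * S2))"
      unfolding 1 by (simp add: algebra_simps)
  qed
  \<comment> \<open>Undo the compression: \<open>E = G * L * L = L * L * G\<close> expresses
    \<open>S\<close> through \<open>S2\<close>.\<close>
  have "S = E * S * E" by (simp add: SE ES)
  also have "\<dots> = G * K * S * (K * G)" by (simp add: K)
  also have "\<dots> = G * L * S2 * L * G"
    by (simp add: S2_def mult.assoc flip: L(2))
  also have "\<dots> = 0" using \<open>S2 = 0\<close> by simp
  finally have Z0: "Z = 0" by (simp add: ZK)
  then have "D = 0" using D2' by simp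
  then have R0: "R = 0" using eq_zero_if_st_mult_zero[OF RM] by (simp add: D_def)
  show "A = U * P" using R0 UA Z0 by (simp add: R_def)
  show "B = U * Q" using R0 RB UB Z0 by simp
qed

lemma norm_projection_le:
  assumes "sa E" "E * E = E"
  shows "norm E \<le> 1"
proof -
  have "norm E * norm E = norm E" using norm_sa_sq[OF assms(1)] assms(2) by (simp add: power2_eq_square)
  then show ?thesis by (metis mult_cancel_right2 norm_zero norm_eq_zero order_refl zero_le_one)
qed

text \<open>Here \<open>P * K * Q = Q * K * P\<close> is the parallel sum of two positive elements.
  The upper bound comes from expanding the positive element \<open>(t *\<^sub>R P - s *\<^sub>R Q) *
  K * (t *\<^sub>R P - s *\<^sub>R Q)\<close>.\<close>

lemma norm_parallel_pos:
  assumes P: "pos P" and Q: "pos Q" and K: "pos K" and G: "G = P + Q"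
    and E: "G * K = E" "K * G = E" "E * K = K" "K * E = K" "P * E = P" "Q * E = Q" "E * Q = Q"
    and nz: "norm P > 0" "norm Q > 0"
  shows "norm (P * K * Q) \<le> norm P * norm Q / (norm P + norm Q)"
proof -
  define R where "R = P * K * Q"
  have PM: "P \<in> M" "Q \<in> M" "K \<in> M" "st P = P" "st Q = Q" "st K = K" using P Q K by auto
  have PG: "P = G - Q" by (simp add: G)
  have R1: "R = Q - Q * K * Q"
    unfolding R_def PG by (simp add: left_diff_distrib E)
  have R2: "Q * K * P = R"
    unfolding R1 PG by (simp add: right_diff_distrib mult.assoc E)
  have R3: "P * K * P = P - R"
    unfolding R_def by (subst (2) PG) (simp add: right_diff_distrib mult.assoc E)
  have R4: "Q * K * Q = Q - R" by (simp add: R1)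
  \<comment> \<open>Inserting \<open>G\<close> between two copies of \<open>K\<close> and exchanging
    \<open>P * K * Q\<close> with \<open>Q * K * P\<close> writes \<open>R\<close> as a sum of
    conjugates of \<open>P\<close> and \<open>Q\<close>.\<close>
  have "R = P * K * (P + Q) * K * Q"
    unfolding G[symmetric] by (simp add: R_def mult.assoc E E[THEN mult_assoc_ext])
  also have "\<dots> = (Q * K * P) * K * Q + P * K * (Q * K * P)"
    unfolding R2 by (simp add: R_def distrib_left distrib_right mult.assoc)
  also have "\<dots> = st (K * Q) * P * (K * Q) + st (K * P) * Q * (K * P)"
    using PM by (simp add: mult.assoc)
  finally have pR: "pos R"
    using pos_add[OF pos_conj[OF P, of "K * Q"] pos_conj[OF Q, of "K * P"]] PM by simp
  define a b where "a = norm P" and "b = norm Q"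
  \<comment> \<open>These weights minimise \<open>t\<^sup>2 * a + s\<^sup>2 * b\<close> under
    \<open>s + t = 1\<close>; the minimum is \<open>a * b / (a + b)\<close>.\<close>
  define s t where "s = a / (a + b)" and "t = b / (a + b)"
  have ab: "a > 0" "b > 0" using nz by (auto simp: a_def b_def)
  have st: "s + t = 1" using ab by (simp add: s_def t_def flip: add_divide_distrib)
  have "st (t *\<^sub>R P - s *\<^sub>R Q) * K * (t *\<^sub>R P - s *\<^sub>R Q)
      = t\<^sup>2 *\<^sub>R (P * K * P) + s\<^sup>2 *\<^sub>R (Q * K * Q) - (s * t) *\<^sub>R (P * K * Q) - (s * t) *\<^sub>R (Q * K * P)"
    using PM by (simp add: left_diff_distrib right_diff_distrib scaleR_diff_right power2_eq_square
        mult.commute[of s t])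
  also have "\<dots> = t\<^sup>2 *\<^sub>R P + s\<^sup>2 *\<^sub>R Q - (s + t)\<^sup>2 *\<^sub>R R"
    unfolding R2 R3 R4 R_def[symmetric]
    by (simp add: power2_eq_square algebra_simps) (simp flip: scaleR_add_left)
  also have "\<dots> = t\<^sup>2 *\<^sub>R P + s\<^sup>2 *\<^sub>R Q - R" by (simp add: st)
  finally have "pos (t\<^sup>2 *\<^sub>R P + s\<^sup>2 *\<^sub>R Q - R)"
    using pos_conj[OF K, of "t *\<^sub>R P - s *\<^sub>R Q"] PM by simp
  then have "norm R \<le> norm (t\<^sup>2 *\<^sub>R P + s\<^sup>2 *\<^sub>R Q)"
    by (rule norm_mono[OF pR])
  also have "\<dots> \<le> t\<^sup>2 * a + s\<^sup>2 * b"
    using norm_triangle_ineq[of "t\<^sup>2 *\<^sub>R P" "s\<^sup>2 *\<^sub>R Q"] by (simp add: a_def b_def)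
  also have "\<dots> = a * b / (a + b)"
  proof -
    have "t\<^sup>2 * a + s\<^sup>2 * b = a * b * (a + b) / (a + b)\<^sup>2"
      by (simp add: s_def t_def power_divide power2_eq_square algebra_simps add_divide_distrib)
    then show ?thesis using ab by (simp add: power2_eq_square)
  qed
  finally show ?thesis by (simp add: R_def a_def b_def)
qed

text \<open>The factorisations give parallel summability:
  \<open>A * Y * B = V * (C * Y * C) * W\<close> is \<open>V * C * W\<close> for every {1}-inverse
  \<open>Y\<close> of \<open>C\<close>.\<close>

lemma parallel_sum_bound:
  assumes M: "A \<in> M" "B \<in> M" "X \<in> M" and C: "C = A + B"
    and mp: "C * X * C = C" "X * C * X = X" "st (C * X) = C * X" "st (X * C) = X * C"
    and tri: "psqrt (st C * C) = psqrt (st A * A) + psqrt (st B * B)"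
  shows "\<exists>V W. A = V * C \<and> B = C * W"
    and "A \<noteq> 0 \<Longrightarrow> B \<noteq> 0 \<Longrightarrow> norm (A * X * B) \<le> norm A * norm B / (norm A + norm B)"
proof -
  define P Q G where "P = psqrt (st A * A)" and "Q = psqrt (st B * B)" and "G = psqrt (st C * C)"
  have P: "pos P" "P * P = st A * A" and Q: "pos Q" "Q * Q = st B * B"
    using psqrt[OF pos_st_mult] M by (auto simp: P_def Q_def)
  have CM: "C \<in> M" using M C by simp
  have G: "G = P + Q" using tri by (simp add: P_def Q_def G_def)
  obtain K U E where K: "pos K" "U \<in> M" "st U * U = E" "E * E = E" "U * E = U"
    "G * K = E" "K * G = E" "E * G = G" "G * E = G" "E * K = K" "K * E = K"
    and CU: "C = U * G" and X: "X = K * st U"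
    using polar_mp[OF CM M(3) mp G_def] .
  note tp = triangle_equality_polar[OF P(1) Q(1) M(1) P(2)[symmetric] M(2) Q(2)[symmetric] G K(2,3,4,5) K(1) K(6-11) CU[unfolded C]]
  have E: "sa E" using K(2) by (auto simp flip: K(3))
  have EQ: "E * Q = Q" using arg_cong[OF tp(4), of st] Q E by simp
  show "\<exists>V W. A = V * C \<and> B = C * W"
  proof (intro exI conjI)
    have "U * P * K * st U * C = U * P * (K * (E * G))"
      unfolding CU by (simp add: mult.assoc K(3)[THEN mult_assoc_ext])
    also have "\<dots> = A" by (simp add: K mult.assoc tp(3)) (simp add: tp(1))
    finally show "A = (U * P * K * st U) * C" by simp
    have "C * (K * Q) = U * (G * K) * Q" unfolding CU by (simp add: mult.assoc)
    also have "\<dots> = B" by (simp add: K tp(2))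
    finally show "B = C * (K * Q)" by simp
  qed
  show "norm (A * X * B) \<le> norm A * norm B / (norm A + norm B)" if nz: "A \<noteq> 0" "B \<noteq> 0"
  proof -
    have nP: "norm P = norm A"
      using norm_sa_sq[OF pos_sa[OF P(1)]] cstar[OF M(1)] P(2) by simp
    have nQ: "norm Q = norm B"
      using norm_sa_sq[OF pos_sa[OF Q(1)]] cstar[OF M(2)] Q(2) by simp
    have "(norm U)\<^sup>2 \<le> 1\<^sup>2"
      using cstar[OF K(2)] norm_projection_le[OF E K(4)] K(3) by simp
    then have nU: "norm U \<le> 1" by (rule power2_le_imp_le) simp
    have "A * X * B = U * P * (K * (st U * U)) * Q"
      unfolding X tp(1,2) by (simp add: mult.assoc)
    also have "\<dots> = U * (P * K * Q)" by (simp add: K mult.assoc)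
    finally have "norm (A * X * B) \<le> norm U * norm (P * K * Q)"
      using norm_mult_ineq by metis
    also have "\<dots> \<le> 1 * norm (P * K * Q)" by (intro mult_right_mono nU) simp
    also have "\<dots> \<le> norm P * norm Q / (norm P + norm Q)"
      using norm_parallel_pos[OF P(1) Q(1) K(1) G K(6,7,10,11) tp(3,4) EQ] nz by (simp add: nP nQ)
    finally show ?thesis by (simp add: nP nQ)
  qed
qed

end

section \<open>Operators on Hilbert modules\<close>

text \<open>By Baire, one of the closed sets \<open>E n\<close> contains a ball; differences of its
  points bound all \<open>f i\<close> on a ball around 0. Boundedness of adjointable operators is
  derived from this.\<close>

lemma uniform_boundedness:
  fixes f :: "'i \<Rightarrow> 'x::banach \<Rightarrow> 'y::real_normed_vector"
  assumes lin: "\<And>i. i \<in> I \<Longrightarrow> bounded_linear (f i)"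
    and bdd: "\<And>x. \<exists>c. \<forall>i\<in>I. norm (f i x) \<le> c"
  shows "\<exists>c. \<forall>i\<in>I. \<forall>x. norm (f i x) \<le> c * norm x"
proof -
  define E where "E n = {x. \<forall>i\<in>I. norm (f i x) \<le> real n}" for n
  have closed: "closed (E n)" for n
  proof -
    have "E n = (\<Inter>i\<in>I. {x. norm (f i x) \<le> real n})"
      by (auto simp: E_def)
    also have "closed \<dots>"
      using lin by (intro closed_INT ballI closed_Collect_le continuous_intros)
        (auto intro: linear_continuous_on)
    finally show ?thesis .
  qed
  have UN: "(\<Union>n. E n) = UNIV"
  proof -
    have "\<exists>n. x \<in> E n" for x
    proof -
      obtain c where c: "\<forall>i\<in>I. norm (f i x) \<le> c" using bdd by blast
      obtain n where "c \<le> real n" using real_arch_simple by blast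
      then have "x \<in> E n" using c order_trans by (fastforce simp: E_def)
      then show ?thesis ..
    qed
    then show ?thesis by auto
  qed
  have "\<exists>n. interior (E n) \<noteq> {}"
  proof (rule ccontr)
    assume "\<not> (\<exists>n. interior (E n) \<noteq> {})"
    then have "euclidean interior_of \<Union> (range E) = {}"
      using closed by (intro Baire_category_alt disjI1 completely_metrizable_space_euclidean) auto
    then show False by (simp add: UN)
  qed
  then obtain n x0 where "x0 \<in> interior (E n)" by blast
  then obtain r where r: "r > 0" "cball x0 r \<subseteq> E n"
    by (auto simp: mem_interior_cball)
  have "norm (f i x) \<le> (2 * real n / r) * norm x" if i: "i \<in> I" for i x
  proof (cases "x = 0")
    case True
    then show ?thesis using lin[OF i] by (simp add: linear_simps)
  next
    case False
    define y where "y = (r / norm x) *\<^sub>R x"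
    have "norm y = r" using False r by (simp add: y_def)
    then have "x0 + y \<in> E n" "x0 \<in> E n" using r by (auto simp: dist_norm subset_iff)
    then have b: "norm (f i (x0 + y)) \<le> real n" "norm (f i x0) \<le> real n"
      using i by (auto simp: E_def)
    have "f i y = f i (x0 + y) - f i x0"
      using lin[OF i] by (simp add: linear_simps)
    then have "norm (f i y) \<le> 2 * real n"
      using b norm_triangle_ineq4[of "f i (x0 + y)" "f i x0"] by simp
    moreover have "f i x = (norm x / r) *\<^sub>R f i y"
      using lin[OF i] False r by (simp add: y_def linear_simps)
    ultimately show ?thesis
      using r by (simp add: divide_right_mono mult.commute mult_left_mono)
  qed
  then show ?thesis by blast
qed

text \<open>
  Endomorphisms as a type of their own, so that composition can be the multiplication of an algebra.
\<close>

typedef (overloaded) 'h endo = "UNIV :: ('h::real_normed_vector \<Rightarrow>\<^sub>L 'h) set"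
  morphisms blinfun_of_endo endo_of_blinfun by simp

setup_lifting type_definition_endo

lift_definition app :: "'h::real_normed_vector endo \<Rightarrow> 'h \<Rightarrow> 'h" is blinfun_apply .

lemma endo_eqI: "(\<And>x. app S x = app T x) \<Longrightarrow> S = T"
  by transfer (rule blinfun_eqI)

instantiation endo :: (real_normed_vector) "{real_normed_algebra, monoid_mult}"
begin

lift_definition zero_endo :: "'a endo" is 0 .
lift_definition one_endo :: "'a endo" is id_blinfun .
lift_definition plus_endo :: "'a endo \<Rightarrow> 'a endo \<Rightarrow> 'a endo" is "(+)" .
lift_definition minus_endo :: "'a endo \<Rightarrow> 'a endo \<Rightarrow> 'a endo" is "(-)" .
lift_definition uminus_endo :: "'a endo \<Rightarrow> 'a endo" is uminus .
lift_definition times_endo :: "'a endo \<Rightarrow> 'a endo \<Rightarrow> 'a endo" is "(o\<^sub>L)" .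
lift_definition scaleR_endo :: "real \<Rightarrow> 'a endo \<Rightarrow> 'a endo" is scaleR .
lift_definition norm_endo :: "'a endo \<Rightarrow> real" is norm .

definition "dist S T = norm (S - T)" for S T :: "'a endo"
definition "sgn S = inverse (norm S) *\<^sub>R S" for S :: "'a endo"
definition "(uniformity :: ('a endo \<times> 'a endo) filter) = (INF e\<in>{0 <..}. principal {(x, y). dist x y < e})"
definition "open U = (\<forall>x\<in>U. eventually (\<lambda>(x', y). x' = x \<longrightarrow> y \<in> U) uniformity)" for U :: "'a endo set"

instance
proof
  fix a b c :: "'a endo" and r s :: real
  show "a + b + c = a + (b + c)" "a + b = b + a" "0 + a = a" "- a + a = 0" "a - b = a + - b"
    by (transfer, simp)+
  show "r *\<^sub>R (a + b) = r *\<^sub>R a + r *\<^sub>R b" "(r + s) *\<^sub>R a = r *\<^sub>R a + s *\<^sub>R a"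
    "r *\<^sub>R s *\<^sub>R a = (r * s) *\<^sub>R a" "1 *\<^sub>R a = a"
    by (transfer, simp add: algebra_simps)+
  show "a * b * c = a * (b * c)" "1 * a = a" "a * 1 = a"
    by (transfer, auto intro: blinfun_eqI)+
  show "(a + b) * c = a * c + b * c" "a * (b + c) = a * b + a * c"
    "(r *\<^sub>R a) * b = r *\<^sub>R (a * b)" "a * (r *\<^sub>R b) = r *\<^sub>R (a * b)"
    by (transfer, auto intro: blinfun_eqI simp: blinfun.bilinear_simps)+
  show "norm (a + b) \<le> norm a + norm b"
    by transfer (rule norm_triangle_ineq)
  show "norm a = 0 \<longleftrightarrow> a = 0" "norm (r *\<^sub>R a) = \<bar>r\<bar> * norm a"
    by (transfer, simp)+
  show "norm (a * b) \<le> norm a * norm b"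
    by transfer (rule norm_blinfun_compose)
qed (fact dist_endo_def sgn_endo_def uniformity_endo_def open_endo_def)+

end

instance endo :: (banach) banach
proof
  fix X :: "nat \<Rightarrow> 'a endo"
  assume "Cauchy X"
  then have "Cauchy (\<lambda>n. blinfun_of_endo (X n))"
    unfolding Cauchy_altdef2 dist_norm by transfer
  then obtain l where "(\<lambda>n. blinfun_of_endo (X n)) \<longlonglongrightarrow> l"
    using Cauchy_convergent convergent_def by blast
  then have "X \<longlonglongrightarrow> endo_of_blinfun l"
    unfolding LIMSEQ_iff by (simp add: norm_endo.rep_eq minus_endo.rep_eq endo_of_blinfun_inverse)
  then show "convergent X" by (auto simp: convergent_def)
qed

lemma bounded_bilinear_app: "bounded_bilinear app"
proof
  fix S T :: "'a endo" and x y :: 'a and r :: real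
  show "app (S + T) x = app S x + app T x" "app S (x + y) = app S x + app S y"
    "app (r *\<^sub>R S) x = r *\<^sub>R app S x" "app S (r *\<^sub>R x) = r *\<^sub>R app S x"
    by (transfer, simp add: blinfun.bilinear_simps)+
next
  show "\<exists>K. \<forall>(S::'a endo) x. norm (app S x) \<le> norm S * norm x * K"
    by (rule exI[of _ 1], transfer) (simp add: norm_blinfun)
qed

lemma app_simps [simp]:
  "app (S * T) x = app S (app T x)" "app 1 x = x" "app (S + T) x = app S x + app T x"
  "app (S - T) x = app S x - app T x" "app (- S) x = - app S x" "app (r *\<^sub>R S) x = r *\<^sub>R app S x"
  "app 0 x = 0"
  by (transfer, simp add: blinfun.bilinear_simps)+

lemma norm_app: "norm (app T x) \<le> norm T * norm x"
  by transfer (rule norm_blinfun)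

lemma norm_endo_eq_onorm: "norm T = onorm (app T)"
  by transfer (rule norm_blinfun.rep_eq)

definition endo_of :: "('h::real_normed_vector \<Rightarrow> 'h) \<Rightarrow> 'h endo" where
  "endo_of f = endo_of_blinfun (Blinfun f)"

lemma app_endo_of [simp]: "bounded_linear f \<Longrightarrow> app (endo_of f) = f"
  unfolding endo_of_def app.rep_eq
  by (simp add: endo_of_blinfun_inverse bounded_linear_Blinfun_apply)

lemma endo_of_app [simp]: "endo_of (app T) = T"
  unfolding endo_of_def app.rep_eq
  by (simp add: blinfun_of_endo_inverse blinfun_apply_inverse)

lemma scaleC_i_i: "\<i> *\<^sub>C \<i> *\<^sub>C x = - (x::'x::complex_vector)"
proof -
  have "\<i> *\<^sub>C \<i> *\<^sub>C x = complex_of_real (-1) *\<^sub>C x"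
    by (simp only: scaleC_scaleC i_squared of_real_minus of_real_1)
  then show ?thesis by (simp only: scaleR_scaleC[symmetric]) simp
qed

context hilbert_module
begin

lemma ip_add_left: "ip (x + y) z = ip x z + ip y z"
  by (metis ip_star ip_add_right star_add)

lemma ip_scaleC_left: "ip (c *\<^sub>C x) y = cnj c *\<^sub>C ip x y"
  by (metis ip_star ip_scaleC_right star_scaleC)

lemma ip_scaleR: "ip (r *\<^sub>R x) y = r *\<^sub>R ip x y" "ip x (r *\<^sub>R y) = r *\<^sub>R ip x y"
  by (simp_all add: scaleR_scaleC ip_scaleC_left ip_scaleC_right)

lemma norm_ip_self: "norm (ip x x) = (norm x)\<^sup>2"
  using norm_ip[of x] by simp

lemma adjointable_adj:
  assumes "adjointable ip T"
  shows "adjointable ip (adj ip T)" "adj ip (adj ip T) = T"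
  using ip_adj_left[OF assms] adj_unique unfolding adjointable_def by blast+

lemma adjointable_add:
  assumes "adjointable ip T"
  shows "T (x + y) = T x + T y"
  by (rule ip_right_cancel) (simp add: ip_add_right flip: ip_adj_left[OF assms])

lemma adjointable_scaleC:
  assumes "adjointable ip T"
  shows "T (c *\<^sub>C x) = c *\<^sub>C T x"
  by (rule ip_right_cancel) (simp add: ip_scaleC_right flip: ip_adj_left[OF assms])

end

text \<open>Cauchy-Schwarz is split off to avoid circularity: its general proof uses the operator
  algebra of the coefficient algebra as a module over itself, where the inequality is
  immediate.\<close>

locale hilbert_module_cs = hilbert_module +
  assumes cauchy_schwarz: "norm (ip x y) \<le> norm x * norm y"
begin

lemma bounded_bilinear_ip: "bounded_bilinear ip"
  by standard (auto simp: ip_add_left ip_add_right ip_scaleR intro!: exI[of _ 1] cauchy_schwarz)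

text \<open>The maps \<open>ip (T x)\<close>, for \<open>x\<close> in the unit ball, are bounded at
  each \<open>y\<close> by \<open>norm (adj ip T y)\<close>, hence uniformly bounded; then take
  \<open>y = T x\<close>.\<close>

lemma adjointable_bounded_linear:
  assumes T: "adjointable ip T"
  shows "bounded_linear T"
proof -
  have "\<exists>c. \<forall>x\<in>{x. norm x \<le> 1}. \<forall>y. norm (ip (T x) y) \<le> c * norm y"
  proof (rule uniform_boundedness)
    show "bounded_linear (ip (T x))" for x
      by (rule bounded_bilinear.bounded_linear_right[OF bounded_bilinear_ip])
    have "norm (ip (T x) y) \<le> norm (adj ip T y)" if "norm x \<le> 1" for x y
      using cauchy_schwarz[of x "adj ip T y"] that mult_right_mono[OF that, of "norm (adj ip T y)"]
      by (simp add: ip_adj[OF T])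
    then show "\<exists>c. \<forall>x\<in>{x. norm x \<le> 1}. norm (ip (T x) y) \<le> c" for y
      by blast
  qed
  then obtain c where c: "\<And>x y. norm x \<le> 1 \<Longrightarrow> norm (ip (T x) y) \<le> c * norm y"
    by blast
  have le: "norm (T x) \<le> \<bar>c\<bar>" if "norm x \<le> 1" for x
  proof (cases "norm (T x) = 0")
    case False
    then show ?thesis
      using c[OF that, of "T x"] by (simp add: norm_ip_self power2_eq_square)
  qed simp
  have sc: "T (r *\<^sub>R x) = r *\<^sub>R T x" for r x
    by (simp add: scaleR_scaleC adjointable_scaleC[OF T])
  show ?thesis
  proof (rule bounded_linear_intro[of _ "\<bar>c\<bar>"])
    fix x
    show "norm (T x) \<le> norm x * \<bar>c\<bar>"
    proof (cases "x = 0")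
      case True
      then show ?thesis using sc[of 0 0] by simp
    next
      case False
      then have "norm (T ((1 / norm x) *\<^sub>R x)) \<le> \<bar>c\<bar>" by (intro le) simp
      then show ?thesis using False by (simp add: sc divide_le_eq mult.commute)
    qed
  qed (use sc adjointable_add[OF T] in auto)
qed

definition ops :: "'a endo set" where
  "ops = {T. adjointable ip (app T)}"

definition op_adj :: "'a endo \<Rightarrow> 'a endo" where
  "op_adj T = endo_of (adj ip (app T))"

definition op_i :: "'a endo" where
  "op_i = endo_of (scaleC \<i>)"

lemma app_op_adj: "T \<in> ops \<Longrightarrow> app (op_adj T) = adj ip (app T)"
  by (simp add: op_adj_def ops_def adjointable_bounded_linear adjointable_adj)

lemma op_adj_ip: "T \<in> ops \<Longrightarrow> ip (app T x) y = ip x (app (op_adj T) y)"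
  by (simp add: app_op_adj) (simp add: ops_def ip_adj)

lemma opsI:
  assumes "\<And>x y. ip (app T x) y = ip x (app S y)"
  shows "T \<in> ops" "op_adj T = S"
proof -
  show "T \<in> ops" using assms by (auto simp: ops_def adjointable_def)
  have "adj ip (app T) = app S" using assms by (rule adj_unique)
  then show "op_adj T = S" by (simp add: op_adj_def)
qed

lemma op_adj_ops:
  assumes "T \<in> ops"
  shows "op_adj T \<in> ops" "op_adj (op_adj T) = T"
proof -
  have "ip (app (op_adj T) x) y = ip x (app T y)" for x y
    by (metis assms ip_star op_adj_ip)
  then show "op_adj T \<in> ops" "op_adj (op_adj T) = T" by (rule opsI)+
qed

lemma norm_op_le:
  assumes T: "T \<in> ops"
  shows "norm (op_adj T) \<le> norm T"
  unfolding norm_endo_eq_onorm[of "op_adj T"]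
proof (rule onorm_bound)
  fix y
  let ?s = "norm (app (op_adj T) y)"
  have "?s\<^sup>2 = norm (ip y (app T (app (op_adj T) y)))"
    by (simp add: op_adj_ops[OF T] op_adj_ip flip: norm_ip_self)
  also have "\<dots> \<le> norm y * norm (app T (app (op_adj T) y))" by (rule cauchy_schwarz)
  also have "\<dots> \<le> norm y * (norm T * ?s)" by (intro mult_left_mono norm_app) auto
  finally have "?s * ?s \<le> (norm T * norm y) * ?s" by (simp add: power2_eq_square mult_ac)
  then show "?s \<le> norm T * norm y"
    by (metis mult_nonneg_nonneg mult_right_le_imp_le norm_ge_zero order_le_less)
qed simp

lemma bounded_linear_scaleC: "bounded_linear (scaleC c :: 'x::complex_normed_vector \<Rightarrow> 'x)"
  by (rule bounded_linear_intro[of _ "cmod c"])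
    (auto simp: scaleC_add_right scaleR_scaleC scaleC_scaleC norm_scaleC mult.commute)

lemma app_op_i: "app op_i x = \<i> *\<^sub>C x"
  by (simp add: op_i_def bounded_linear_scaleC)

interpretation ip: bounded_bilinear ip
  by (rule bounded_bilinear_ip)

lemma op_closure:
  assumes "S \<in> ops" "T \<in> ops"
  shows "S + T \<in> ops" "op_adj (S + T) = op_adj S + op_adj T"
    "S * T \<in> ops" "op_adj (S * T) = op_adj T * op_adj S"
    "r *\<^sub>R S \<in> ops" "op_adj (r *\<^sub>R S) = r *\<^sub>R op_adj S"
    "1 \<in> ops"
proof -
  have 1: "ip (app (S + T) x) y = ip x (app (op_adj S + op_adj T) y)"
    and 2: "ip (app (S * T) x) y = ip x (app (op_adj T * op_adj S) y)"
    and 3: "ip (app (r *\<^sub>R S) x) y = ip x (app (r *\<^sub>R op_adj S) y)"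
    and 4: "ip (app 1 x) y = ip x (app 1 y)" for x y
    by (simp_all add: op_adj_ip assms ip_add_left ip_add_right ip_scaleR)
  show "S + T \<in> ops" "op_adj (S + T) = op_adj S + op_adj T" using 1 by (rule opsI)+
  show "S * T \<in> ops" "op_adj (S * T) = op_adj T * op_adj S" using 2 by (rule opsI)+
  show "r *\<^sub>R S \<in> ops" "op_adj (r *\<^sub>R S) = r *\<^sub>R op_adj S" using 3 by (rule opsI)+
  show "1 \<in> ops" using 4 by (rule opsI)
qed

lemma op_i_ops: "op_i \<in> ops" "op_adj op_i = - op_i"
proof -
  have "ip (app op_i x) y = ip x (app (- op_i) y)" for x y
  proof -
    have "(- \<i>) *\<^sub>C ip x y = - (\<i> *\<^sub>C ip x y)"
      using scaleC_add_left[of "\<i>" "- \<i>" "ip x y"] scaleR_scaleC[of 0 "ip x y"]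
      by (simp add: eq_neg_iff_add_eq_0 add.commute)
    then show ?thesis
      by (simp add: app_op_i ip_scaleC_left ip.minus_right ip_scaleC_right)
  qed
  then show "op_i \<in> ops" "op_adj op_i = - op_i" by (rule opsI)+
qed

text \<open>Taking adjoints is contractive, so the adjoints of a convergent sequence converge too,
  and their limit is an adjoint of the limit.\<close>

lemma closed_ops: "closed ops"
  unfolding closed_sequential_limits
proof (intro allI impI, elim conjE)
  fix X T
  assume X: "\<forall>n. X n \<in> ops" and lim: "X \<longlonglongrightarrow> T"
  have adj_diff: "op_adj (S - R) = op_adj S - op_adj R" "S - R \<in> ops" if "S \<in> ops" "R \<in> ops" for S R
    using op_closure(1,2)[OF that(1) op_closure(5)[OF that(2,2)], of "-1"]
      op_closure(6)[OF that(2,2), of "-1"] by simp_all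
  have "norm (op_adj (X m) - op_adj (X n)) \<le> norm (X m - X n)" for m n
    using norm_op_le[of "X m - X n"] adj_diff[of "X m" "X n"] X by simp
  then have "Cauchy (\<lambda>n. op_adj (X n))"
    using LIMSEQ_imp_Cauchy[OF lim] unfolding Cauchy_def dist_norm by (meson le_less_trans)
  then obtain S where S: "(\<lambda>n. op_adj (X n)) \<longlonglongrightarrow> S"
    using Cauchy_convergent convergent_def by blast
  have "ip (app T x) y = ip x (app S y)" for x y
  proof (rule LIMSEQ_unique)
    show "(\<lambda>n. ip (app (X n) x) y) \<longlonglongrightarrow> ip (app T x) y"
      by (intro ip.tendsto bounded_bilinear.tendsto[OF bounded_bilinear_app] lim tendsto_const)
    have "(\<lambda>n. ip x (app (op_adj (X n)) y)) \<longlonglongrightarrow> ip x (app S y)"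
      by (intro ip.tendsto bounded_bilinear.tendsto[OF bounded_bilinear_app] S tendsto_const)
    then show "(\<lambda>n. ip (app (X n) x) y) \<longlonglongrightarrow> ip x (app S y)"
      using X by (simp add: op_adj_ip)
  qed
  then show "T \<in> ops" by (rule opsI)
qed

lemma op_cstar:
  assumes T: "T \<in> ops"
  shows "norm (op_adj T * T) = (norm T)\<^sup>2"
proof (rule antisym)
  have "norm (op_adj T * T) \<le> norm (op_adj T) * norm T" by (rule norm_mult_ineq)
  also have "\<dots> \<le> norm T * norm T" by (intro mult_right_mono norm_op_le T) simp
  finally show "norm (op_adj T * T) \<le> (norm T)\<^sup>2" by (simp add: power2_eq_square)
  have "norm T \<le> sqrt (norm (op_adj T * T))"
    unfolding norm_endo_eq_onorm[of T]
  proof (rule onorm_bound)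
    fix x
    have "(norm (app T x))\<^sup>2 = norm (ip x (app (op_adj T * T) x))"
      by (simp add: op_adj_ip T flip: norm_ip_self)
    also have "\<dots> \<le> norm x * norm (app (op_adj T * T) x)" by (rule cauchy_schwarz)
    also have "\<dots> \<le> norm x * (norm (op_adj T * T) * norm x)"
      by (intro mult_left_mono norm_app) auto
    also have "\<dots> = (sqrt (norm (op_adj T * T)) * norm x)\<^sup>2"
      by (simp add: power_mult_distrib) (simp add: power2_eq_square)
    finally show "norm (app T x) \<le> sqrt (norm (op_adj T * T)) * norm x"
      by (rule power2_le_imp_le) simp
  qed simp
  then have "(norm T)\<^sup>2 \<le> (sqrt (norm (op_adj T * T)))\<^sup>2" by (rule power_mono) simp
  then show "(norm T)\<^sup>2 \<le> norm (op_adj T * T)" by simp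
qed

sublocale L: unital_cstar ops op_adj op_i
proof
  show "closed ops" by (rule closed_ops)
  show "op_i \<in> ops" "op_adj op_i = - op_i" by (rule op_i_ops)+
  then show "1 \<in> ops" using op_closure(7) by blast
  show "op_i * op_i = - 1" by (rule endo_eqI) (simp add: app_op_i scaleC_i_i)
  show "T * op_i = op_i * T" if "T \<in> ops" for T
    using that by (intro endo_eqI) (simp add: app_op_i adjointable_scaleC ops_def)
qed (auto simp: op_closure op_adj_ops op_cstar)

end

lemma norm_star: "norm (star a) = norm (a::'a::cstar_algebra)"
proof -
  have le: "norm b \<le> norm (star b)" for b :: 'a
  proof (cases "norm b = 0")
    case False
    have "norm b * norm b \<le> norm (star b) * norm b"
      using cstar_identity[of b] norm_mult_ineq[of "star b" b] by (simp add: power2_eq_square)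
    then show ?thesis using False by auto
  qed auto
  show ?thesis
    using le[of a] le[of "star a"] by (simp add: star_star)
qed

text \<open>Here Cauchy-Schwarz is just submultiplicativity of the norm together with
  \<open>norm_star\<close>.\<close>

lemma hilbert_module_self:
  "hilbert_module_cs (*) (\<lambda>x y::'a::cstar_algebra. star x * y)"
proof
  fix x y :: 'a
  show "norm x = sqrt (norm (star x * x))" by (simp add: cstar_identity)
  show "norm (star x * y) \<le> norm x * norm y"
    using norm_mult_ineq[of "star x" y] by (simp add: norm_star)
  show "star x * x = 0 \<Longrightarrow> x = 0" using cstar_identity[of x] by simp
  show "cstar_positive (star x * x)" by (auto simp: cstar_positive_def)
qed (auto simp: algebra_simps scaleC_mult_left scaleC_mult_right star_mult star_star)

text \<open>The left regular representation, which embeds a possibly non-unital algebra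
  isometrically into a unital one.\<close>

definition left_mult :: "'a::cstar_algebra \<Rightarrow> 'a endo" where
  "left_mult a = endo_of ((*) a)"

lemma app_left_mult [simp]: "app (left_mult a) x = a * x"
  by (simp add: left_mult_def bounded_linear_mult_right)

lemma left_mult_simps:
  "left_mult (a * b) = left_mult a * left_mult b" "left_mult (a - b) = left_mult a - left_mult b"
  "left_mult (a + b) = left_mult a + left_mult b" "left_mult (r *\<^sub>R a) = r *\<^sub>R left_mult a"
  by (auto intro!: endo_eqI simp: algebra_simps)

text \<open>The lower bound is obtained by evaluating at \<open>star a\<close>.\<close>

lemma norm_left_mult [simp]: "norm (left_mult a) = norm a"
proof (rule antisym)
  show "norm (left_mult a) \<le> norm a"
    unfolding norm_endo_eq_onorm by (rule onorm_bound) (auto simp: norm_mult_ineq)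
  have "norm a * norm a = norm (app (left_mult a) (star a))"
    using cstar_identity[of "star a"] by (simp add: star_star norm_star power2_eq_square)
  also have "\<dots> \<le> norm (left_mult a) * norm a"
    using norm_app[of "left_mult a" "star a"] by (simp add: norm_star)
  finally show "norm a \<le> norm (left_mult a)"
    by (cases "norm a = 0") (auto simp: mult_le_cancel_right)
qed

context hilbert_module
begin

lemma ip_diff: "ip (x - y) z = ip x z - ip y z" "ip z (x - y) = ip z x - ip z y"
  using ip_add_left[of "x - y" y z] ip_add_right[of z "x - y" y] by simp_all

lemma ip_act_left: "ip (act x a) y = star a * ip x y"
  by (metis ip_star ip_act_right star_mult)

text \<open>
  The order on the C*-algebra is that of the operators of left multiplication on the algebra, viewed
  as a module over itself. Expand \<open>ip z z \<ge> 0\<close> for \<open>z = act x (ip x y) - n *\<^sub>R y\<close>, where \<open>n\<close> is the norm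
  of \<open>ip x x\<close>.
\<close>

lemma cauchy_schwarz_ineq: "norm (ip x y) \<le> norm x * norm y"
proof -
  interpret A: hilbert_module_cs "(*)" "\<lambda>x y::'a. star x * y"
    by (rule hilbert_module_self)
  have lm: "left_mult a \<in> A.ops" "A.op_adj (left_mult a) = left_mult (star a)" for a
  proof -
    have "star (app (left_mult a) u) * v = star u * app (left_mult (star a)) v" for u v
      by (simp add: star_mult mult.assoc)
    then show "left_mult a \<in> A.ops" "A.op_adj (left_mult a) = left_mult (star a)"
      by (rule A.opsI)+
  qed
  have pos: "A.L.pos (left_mult (ip z z))" for z
    using ip_positive[of z] A.L.pos_st_mult[OF lm(1)]
    by (auto simp: cstar_positive_def left_mult_simps lm(2))
  define n where "n = norm (ip x x)"
  define c where "c = ip x y"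
  have n0: "n \<ge> 0" by (simp add: n_def)
  have c: "ip y x = star c" by (simp add: c_def ip_star)
  define z where "z = act x c - n *\<^sub>R y"
  have "ip z z + (n *\<^sub>R (star c * c) - star c * ip x x * c)
      = n\<^sup>2 *\<^sub>R ip y y - n *\<^sub>R (star c * c)"
    by (simp add: z_def ip_diff ip_scaleR ip_act_left ip_act_right c c_def[symmetric]
        power2_eq_square algebra_simps)
  then have z: "left_mult (ip z z) + left_mult (n *\<^sub>R (star c * c) - star c * ip x x * c)
      = left_mult (n\<^sup>2 *\<^sub>R ip y y) - left_mult (n *\<^sub>R (star c * c))"
    by (simp only: left_mult_simps(2,3)[symmetric])
  \<comment> \<open>Conjugating this by \<open>c\<close> controls the term
    \<open>star c * ip x x * c\<close> in the expansion of \<open>ip z z\<close>.\<close>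
  have "A.L.pos (n *\<^sub>R 1 - left_mult (ip x x))"
    by (rule A.L.pos_norm_diff[OF pos]) (simp add: n_def)
  from A.L.pos_conj[OF this lm(1)[of c]]
  have "A.L.pos (left_mult (n *\<^sub>R (star c * c) - star c * ip x x * c))"
    by (simp add: lm left_mult_simps left_diff_distrib right_diff_distrib mult.assoc)
  from A.L.pos_add[OF pos[of z] this]
  have p: "A.L.pos (left_mult (n\<^sup>2 *\<^sub>R ip y y) - left_mult (n *\<^sub>R (star c * c)))"
    unfolding z .
  have "A.L.pos (left_mult (n *\<^sub>R (star c * c)))"
    using A.L.pos_scaleR[OF A.L.pos_st_mult[OF lm(1)[of c]] n0] by (simp add: lm left_mult_simps)
  from A.L.norm_mono[OF this p] have "n * (norm c)\<^sup>2 \<le> n\<^sup>2 * (norm y)\<^sup>2"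
    using n0 by (simp add: cstar_identity norm_ip_self)
  moreover have n: "n = (norm x)\<^sup>2" by (simp add: n_def norm_ip_self)
  ultimately have le: "(norm x)\<^sup>2 * (norm c)\<^sup>2 \<le> (norm x)\<^sup>2 * (norm x * norm y)\<^sup>2"
    by (simp add: power2_eq_square mult_ac)
  show ?thesis
  proof (cases "x = 0")
    case True
    then have "ip x y = 0" using ip_scaleR(1)[of 0 x y] by simp
    then show ?thesis by simp
  next
    case False
    then have "(norm c)\<^sup>2 \<le> (norm x * norm y)\<^sup>2" using le by simp
    then show ?thesis unfolding c_def by (rule power2_le_imp_le) simp
  qed
qed

end

section \<open>Translation between adjointable functions and elements of \<open>ops\<close>\<close>

context hilbert_module_cs
begin

lemma endo_of_ops:
  assumes "adjointable ip T"
  shows "endo_of T \<in> ops" "app (endo_of T) = T" "op_adj (endo_of T) = endo_of (adj ip T)"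
  using assms by (simp_all add: ops_def op_adj_def adjointable_bounded_linear)

lemma app_comp: "app S \<circ> app T = app (S * T)"
  by auto

text \<open>Fukamiya's theorem \<open>pos_st_mult\<close> gives one direction, the positive square
  root the other.\<close>

lemma positive_op_iff: "positive_op ip S \<longleftrightarrow> (\<exists>s. L.pos s \<and> S = app s)"
proof
  assume "positive_op ip S"
  then obtain R where R: "adjointable ip R" "S = adj ip R \<circ> R" by (auto simp: positive_op_def)
  define r where "r = endo_of R"
  have r: "r \<in> ops" "app r = R" using endo_of_ops[OF R(1)] by (auto simp: r_def)
  then have "S = app (op_adj r * r)" by (simp add: R(2) app_op_adj flip: app_comp)
  then show "\<exists>s. L.pos s \<and> S = app s" using L.pos_st_mult[OF r(1)] by blast
next
  assume "\<exists>s. L.pos s \<and> S = app s"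
  then obtain s where s: "L.pos s" "S = app s" by blast
  define y where "y = L.psqrt s"
  have y: "y \<in> ops" "op_adj y = y" "y * y = s" using L.psqrt[OF s(1)] by (auto simp: y_def)
  have "S = adj ip (app y) \<circ> app y"
    using y by (simp add: s(2) app_comp flip: app_op_adj)
  then show "positive_op ip S" using y by (auto simp: positive_op_def ops_def)
qed

text \<open>Uniqueness of positive roots in \<open>ops\<close> shows that the definite description
  in \<open>sqrt_op\<close> denotes.\<close>

lemma abs_op_eq:
  assumes "adjointable ip T"
  shows "abs_op ip T = app (L.psqrt (op_adj (endo_of T) * endo_of T))"
proof -
  define t where "t = endo_of T"
  have t: "t \<in> ops" "app t = T" using endo_of_ops[OF assms] by (auto simp: t_def)
  note p = L.pos_st_mult[OF t(1)]
  have T: "adj ip T \<circ> T = app (op_adj t * t)"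
    using t by (simp add: app_op_adj flip: app_comp)
  have "sqrt_op ip (adj ip T \<circ> T) = app (L.psqrt (op_adj t * t))"
    unfolding sqrt_op_def T
  proof (rule the_equality)
    show "positive_op ip (app (L.psqrt (op_adj t * t))) \<and>
        app (L.psqrt (op_adj t * t)) \<circ> app (L.psqrt (op_adj t * t)) = app (op_adj t * t)"
      using L.psqrt[OF p] positive_op_iff unfolding app_comp by metis
  next
    fix S assume "positive_op ip S \<and> S \<circ> S = app (op_adj t * t)"
    then obtain s where s: "L.pos s" "S = app s" "app (s * s) = app (op_adj t * t)"
      unfolding positive_op_iff by (auto simp: app_comp)
    then have "s * s = op_adj t * t" by (metis endo_of_app)
    then show "S = app (L.psqrt (op_adj t * t))" using L.psqrt_eq[OF s(1)] s(2) by simp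
  qed
  then show ?thesis by (simp add: abs_op_def t_def)
qed

lemma endo_of_plus_op:
  assumes "adjointable ip S" "adjointable ip T"
  shows "endo_of (plus_op S T) = endo_of S + endo_of T" "adjointable ip (plus_op S T)"
proof -
  have eq: "plus_op S T = app (endo_of S + endo_of T)"
    using endo_of_ops(2)[OF assms(1)] endo_of_ops(2)[OF assms(2)] by (auto simp: plus_op_def)
  then show "endo_of (plus_op S T) = endo_of S + endo_of T" by simp
  have "endo_of S + endo_of T \<in> ops" using endo_of_ops(1) assms by simp
  then show "adjointable ip (plus_op S T)" unfolding eq ops_def by simp
qed

lemma endo_of_comp:
  assumes "adjointable ip S" "adjointable ip T"
  shows "endo_of (S \<circ> T) = endo_of S * endo_of T"
  using endo_of_ops(2)[OF assms(1)] endo_of_ops(2)[OF assms(2)] app_comp endo_of_app by metis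

lemma endo_of_mp_inverse:
  assumes C: "adjointable ip C" and X: "is_mp_inverse ip C X"
  defines "c \<equiv> endo_of C" and "x \<equiv> endo_of X"
  shows "x \<in> ops" "c * x * c = c" "x * c * x = x" "op_adj (c * x) = c * x" "op_adj (x * c) = x * c"
proof -
  have aX: "adjointable ip X" and eqs: "C \<circ> X \<circ> C = C" "X \<circ> C \<circ> X = X"
    "adj ip (C \<circ> X) = C \<circ> X" "adj ip (X \<circ> C) = X \<circ> C"
    using X by (auto simp: is_mp_inverse_def)
  have CX: "adjointable ip (C \<circ> X)" and XC: "adjointable ip (X \<circ> C)"
    using adjointable_comp(1) C aX by auto
  have cx: "endo_of (C \<circ> X) = c * x" and xc: "endo_of (X \<circ> C) = x * c"
    using endo_of_comp C aX by (auto simp: c_def x_def)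
  show "x \<in> ops" using endo_of_ops(1)[OF aX] by (simp add: x_def)
  show "c * x * c = c" "x * c * x = x"
    using endo_of_comp[OF CX C] endo_of_comp[OF XC aX] unfolding cx xc eqs by (auto simp: c_def x_def)
  show "op_adj (c * x) = c * x" "op_adj (x * c) = x * c"
    using endo_of_ops(3)[OF CX] endo_of_ops(3)[OF XC] unfolding eqs cx xc by auto
qed

end

theorem theorem5p4:
  fixes act :: "'h::{complex_normed_vector, banach} \<Rightarrow> 'a::cstar_algebra \<Rightarrow> 'h"
    and ip :: "'h \<Rightarrow> 'h \<Rightarrow> 'a"
    and A B :: "'h \<Rightarrow> 'h"
  assumes "hilbert_module act ip"
    and "adjointable ip A" and "adjointable ip B"
    and "A \<noteq> (\<lambda>x. 0)" and "B \<noteq> (\<lambda>x. 0)"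
    and "abs_op ip (plus_op A B) = plus_op (abs_op ip A) (abs_op ip B)"
    and "mp_invertible ip (plus_op A B)"
  shows "parallel_summable ip A B \<and>
    onorm (parallel_sum ip A B) \<le> onorm A * onorm B / (onorm A + onorm B)"
proof -
  interpret hilbert_module act ip by fact
  interpret hilbert_module_cs act ip by standard (rule cauchy_schwarz_ineq)
  define C where "C = plus_op A B"
  define a b c where "a = endo_of A" and "b = endo_of B" and "c = endo_of C"
  have C: "adjointable ip C" and c: "c = a + b"
    using endo_of_plus_op[OF assms(2,3)] by (auto simp: C_def a_def b_def c_def)
  have ab: "a \<in> ops" "b \<in> ops" and app: "app a = A" "app b = B" "app c = C"
    using endo_of_ops[OF assms(2)] endo_of_ops[OF assms(3)] endo_of_ops[OF C]
    by (auto simp: a_def b_def c_def)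
  obtain X where X: "is_mp_inverse ip C X"
    using assms(7) by (auto simp: mp_invertible_def C_def)
  define x where "x = endo_of X"
  have aX: "adjointable ip X" using X by (simp add: is_mp_inverse_def)
  note x = endo_of_mp_inverse[OF C X, folded c_def x_def]
  have "app (L.psqrt (op_adj c * c)) = app (L.psqrt (op_adj a * a) + L.psqrt (op_adj b * b))"
    using assms(6) abs_op_eq[OF C] abs_op_eq[OF assms(2)] abs_op_eq[OF assms(3)]
    by (simp add: C_def plus_op_def a_def b_def c_def fun_eq_iff)
  then have tri: "L.psqrt (op_adj c * c) = L.psqrt (op_adj a * a) + L.psqrt (op_adj b * b)"
    by (metis endo_of_app)
  note bound = L.parallel_sum_bound[OF ab x(1) c x(2-5) tri]
  obtain v w where vw: "a = v * c" "b = c * w" using bound(1) by blast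
  have A: "A = app v \<circ> C" and B: "B = C \<circ> app w"
    using arg_cong[OF vw(1), of app] arg_cong[OF vw(2), of app] app by (auto simp flip: app_comp)
  \<comment> \<open>Only \<open>C \<circ> Y \<circ> C = C\<close> enters, so the product is the same
    for all {1}-inverses.\<close>
  have one: "A \<circ> Y \<circ> B = app v \<circ> C \<circ> app w" if "C \<circ> Y \<circ> C = C" for Y
  proof -
    have "A \<circ> Y \<circ> B = app v \<circ> (C \<circ> Y \<circ> C) \<circ> app w" by (simp only: A B comp_assoc)
    then show ?thesis by (simp only: that)
  qed
  have summable: "parallel_summable ip A B"
    using assms(2,3,7) one unfolding parallel_summable_def is_one_inverse_def C_def by metis
  have "mp_inverse ip C = X"
    unfolding mp_inverse_def using X is_mp_inverse_unique[OF C] by (intro the_equality) auto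
  then have sum: "parallel_sum ip A B = app (a * x * b)"
    using endo_of_ops(2)[OF aX] app by (simp add: parallel_sum_def C_def x_def flip: app_comp)
  have "a \<noteq> 0" "b \<noteq> 0" using assms(4,5) app by (auto simp: fun_eq_iff)
  from bound(2)[OF this] show ?thesis
    using summable by (simp add: sum app norm_endo_eq_onorm)
qed

end
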